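(* Let $(w,u)$ be an admissible design, for the controlled experiment described in the context, for which at least one measurement is taken (i.e. $w_{i,d}=1$ for some $(i,d)$), and define $$ K_{\mathrm{time}}(w):=\operatorname{card}\Bigl\{i\in\{1,\dots,M\}:\ \sum_{d=1}^{n_{\mathrm{exp}}}w_{i,d}>0\Bigr\}. $$ Then $$ \frac{1}{K_{\mathrm{time}}(w)}\,J_{\mathrm{inst}}(w,u)\;\le\;J_{\mathrm{EIG}}(w,u)\;\le\;J_{\mathrm{inst}}(w,u). $$ Moreover, the budget constraint $\sum_{i=1}^{M}\sum_{d=1}^{n_{\mathrm{exp}}}w_{i,d}\le K$ implies $K_{\mathrm{time}}(w)\le K$, and therefore $$ \frac{1}{K}\,J_{\mathrm{inst}}(w,u)\;\le\;J_{\mathrm{EIG}}(w,u)\;\le\;J_{\mathrm{inst}}(w,u). $$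
   Context: Dynamics: $x(t;u,\theta)\in\mathbb{R}^{n_x}$, $t\in[0,T]$, is the unique solution of $\dot x(t)=f(x(t),u(t),\theta,t)$, $x(0)=x_0$, where $u$ is a measurable control with values in a compact set $U\subset\mathbb{R}^{n_u}$ and $\theta\in\mathbb{R}^{n_\theta}$ is an unknown random parameter with prior density $p_0$. The function $f$ is assumed regular enough that existence and uniqueness hold for every such $u$ and $\theta$. Observations: there are candidate times $t_1,\dots,t_M\in[0,T]$ and $n_{\mathrm{exp}}$ sensors with observation functions $h_d:\mathbb{R}^{n_x}\to\mathbb{R}^{n_y}$. A (non-adaptive, deterministic) design is a pair $(w,u)$ with sampling weights $w=(w_{i,d})_{1\le i\le M,\,1\le d\le n_{\mathrm{exp}}}$, $w_{i,d}\in\{0,1\}$; it is admissible if $u:[0,T]\to U$ is a measurable control with values in the compact set $U\subset\mathbb{R}^{n_u}$ and the budget constraint $\sum_{i=1}^M\sum_{d=1}^{n_{\mathrm{exp}}}w_{i,d}\le K$ holds, where $K$ is a given budget. If $w_{i,d}=1$, then $y_{i,d}=h_d(x(t_i;u,\theta))+\varepsilon_{i,d}$, where the $\varepsilon_{i,d}$ are mutually independent random variables, independent of $\theta$, with densities $p_{\varepsilon_{i,d}}$. If $w_{i,d}=0$, then $y_{i,d}=c$ deterministically, where $c\notin\mathbb{R}^{n_y}$ is a fixed "cemetery" value. Put $y_i=(y_{i,d})_{1\le d\le n_{\mathrm{exp}}}$ and $y=y_{1:M}=(y_1,\dots,y_M)$. Consequently $y_1,\dots,y_M$ are conditionally independent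 given $\theta$. Conditioning on $(w,u)$ is purely parametric. All relevant densities are assumed to exist and all information-theoretic quantities considered are assumed to be well defined and finite. Definitions: - $J_{\mathrm{inst}}(w,u):=\sum_{i=1}^M I_{\mathrm{inst}}(\theta;y_i\mid w,u)$, where $I_{\mathrm{inst}}(\theta;y_i\mid w,u):=\mathbb{E}\bigl[\log p(y_i\mid\theta,w,u)-\log p(y_i\mid w,u)\bigr]$, the expectation being over $p_0(\theta)\,p(y_i\mid\theta,w,u)$ and $p(y_i\mid w,u)=\int p(y_i\mid\theta',w,u)\,p_0(\theta')\,d\theta'$; i.e. it is the mutual information between $\theta\sim p_0$ and $y_i$; - $J_{\mathrm{EIG}}(w,u):=\mathbb{E}\bigl[\log\frac{p(y\mid\theta,w,u)}{p(y\mid w,u)}\bigr]$, the expectation being over $p_0(\theta)\,p(y\mid\theta,w,u)$; i.e. it is the mutual information between $\theta$ and $y=y_{1:M}$. *)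

theory Defs
  imports "HOL-Probability.Probability"
begin

definition absolutely_continuous_fun ::
    "real \<Rightarrow> real \<Rightarrow> (real \<Rightarrow> 'b::metric_space) \<Rightarrow> bool" where
  "absolutely_continuous_fun a b x \<longleftrightarrow>
    (\<forall>e>0. \<exists>\<delta>>0. \<forall>(n::nat) (l::nat \<Rightarrow> real) (r::nat \<Rightarrow> real).
      (\<forall>k<n. a \<le> l k \<and> l k \<le> r k \<and> r k \<le> b) \<and>
      disjoint_family_on (\<lambda>k. {l k<..<r k}) {..<n} \<and> (\<Sum>k<n. r k - l k) < \<delta>
      \<longrightarrow> (\<Sum>k<n. dist (x (l k)) (x (r k))) < e)"

text \<open>
  Everything that is fixed in the controlled experiment. \<open>sample_space\<close> is the probability space
  carrying the random parameter \<open>param\<close> and the noise variables \<open>noise i d\<close>. Candidate times are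
  indexed by \<open>{1..num_times}\<close>, sensors by \<open>{1..num_sensors}\<close>.
\<close>

record ('nx::finite, 'nu::finite, 'nt::finite, 'ny::finite, 'o) exp_model =
  horizon :: real
  rhs :: "real^'nx \<Rightarrow> real^'nu \<Rightarrow> real^'nt \<Rightarrow> real \<Rightarrow> real^'nx"
  init_state :: "real^'nx"
  control_set :: "(real^'nu) set"
  num_times :: nat
  obs_time :: "nat \<Rightarrow> real"
  num_sensors :: nat
  sensor :: "nat \<Rightarrow> real^'nx \<Rightarrow> real^'ny"
  budget :: nat
  sample_space :: "'o measure"
  param :: "'o \<Rightarrow> real^'nt"
  prior :: "real^'nt \<Rightarrow> real"
  noise :: "nat \<Rightarrow> nat \<Rightarrow> 'o \<Rightarrow> real^'ny"
  noise_density :: "nat \<Rightarrow> nat \<Rightarrow> real^'ny \<Rightarrow> real"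

definition controls ::
    "('nx::finite, 'nu::finite, 'nt::finite, 'ny::finite, 'o) exp_model \<Rightarrow> (real \<Rightarrow> real^'nu) set" where
  "controls E = {u. u \<in> borel_measurable (lebesgue_on {0..horizon E}) \<and>
                    (\<forall>s\<in>{0..horizon E}. u s \<in> control_set E)}"

text \<open>
  Since controls are merely measurable, a solution of the differential equation is understood in
  the sense of Caratheodory. Solutions live on \<open>[0,T]\<close>; for uniqueness as total functions they are
  taken to be undefined outside.
\<close>

definition is_solution ::
    "('nx::finite, 'nu::finite, 'nt::finite, 'ny::finite, 'o) exp_model \<Rightarrow> (real \<Rightarrow> real^'nu) \<Rightarrow>
     real^'nt \<Rightarrow> (real \<Rightarrow> real^'nx) \<Rightarrow> bool" where
  "is_solution E u \<theta> x \<longleftrightarrow>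
     x \<in> extensional {0..horizon E} \<and>
     absolutely_continuous_fun 0 (horizon E) x \<and>
     x 0 = init_state E \<and>
     (AE s in lebesgue_on {0..horizon E}.
        (x has_vector_derivative rhs E (x s) (u s) \<theta> s) (at s within {0..horizon E}))"

definition trajectory ::
    "('nx::finite, 'nu::finite, 'nt::finite, 'ny::finite, 'o) exp_model \<Rightarrow> (real \<Rightarrow> real^'nu) \<Rightarrow>
     real^'nt \<Rightarrow> real \<Rightarrow> real^'nx" where
  "trajectory E u \<theta> = (THE x. is_solution E u \<theta> x)"

definition noise_vec ::
    "('nx::finite, 'nu::finite, 'nt::finite, 'ny::finite, 'o) exp_model \<Rightarrow> 'o \<Rightarrow> nat \<times> nat \<Rightarrow> real^'ny" where
  "noise_vec E \<omega> = (\<lambda>p\<in>{1..num_times E} \<times> {1..num_sensors E}. noise E (fst p) (snd p) \<omega>)"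

text \<open>
  The measurability condition on the noise-free observations is part of the standing assumption
  that the observations are random variables with a conditional density given the parameter.
\<close>

definition controlled_experiment ::
    "('nx::finite, 'nu::finite, 'nt::finite, 'ny::finite, 'o) exp_model \<Rightarrow> bool" where
  "controlled_experiment E \<longleftrightarrow>
     0 \<le> horizon E \<and>
     compact (control_set E) \<and>
     (\<forall>i\<in>{1..num_times E}. obs_time E i \<in> {0..horizon E}) \<and>
     (\<forall>u\<in>controls E. \<forall>\<theta>. \<exists>!x. is_solution E u \<theta> x) \<and>
     (\<forall>u\<in>controls E. \<forall>i\<in>{1..num_times E}. \<forall>d\<in>{1..num_sensors E}.
        (\<lambda>\<theta>. sensor E d (trajectory E u \<theta> (obs_time E i))) \<in> borel_measurable borel) \<and>
     prob_space (sample_space E) \<and>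
     (\<forall>\<theta>. 0 \<le> prior E \<theta>) \<and>
     distributed (sample_space E) lborel (param E) (\<lambda>\<theta>. ennreal (prior E \<theta>)) \<and>
     (\<forall>i\<in>{1..num_times E}. \<forall>d\<in>{1..num_sensors E}.
        (\<forall>v. 0 \<le> noise_density E i d v) \<and>
        distributed (sample_space E) lborel (noise E i d) (\<lambda>v. ennreal (noise_density E i d v))) \<and>
     prob_space.indep_vars (sample_space E) (\<lambda>_. borel) (\<lambda>(i, d). noise E i d)
       ({1..num_times E} \<times> {1..num_sensors E}) \<and>
     prob_space.indep_set (sample_space E)
       {param E -` A \<inter> space (sample_space E) | A. A \<in> sets borel}
       {noise_vec E -` B \<inter> space (sample_space E) | B.
          B \<in> sets (PiM ({1..num_times E} \<times> {1..num_sensors E}) (\<lambda>_. borel))}"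

definition admissible ::
    "('nx::finite, 'nu::finite, 'nt::finite, 'ny::finite, 'o) exp_model \<Rightarrow>
     (nat \<Rightarrow> nat \<Rightarrow> nat) \<Rightarrow> (real \<Rightarrow> real^'nu) \<Rightarrow> bool" where
  "admissible E w u \<longleftrightarrow>
     (\<forall>i\<in>{1..num_times E}. \<forall>d\<in>{1..num_sensors E}. w i d \<in> {0, 1}) \<and>
     u \<in> controls E \<and>
     (\<Sum>i\<in>{1..num_times E}. \<Sum>d\<in>{1..num_sensors E}. w i d) \<le> budget E"

text \<open>A single observation \<open>y\<^sub>i\<^sub>,\<^sub>d\<close>; the constructor \<open>None\<close> is the cemetery value.\<close>

definition obs1 ::
    "('nx::finite, 'nu::finite, 'nt::finite, 'ny::finite, 'o) exp_model \<Rightarrow>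
     (nat \<Rightarrow> nat \<Rightarrow> nat) \<Rightarrow> (real \<Rightarrow> real^'nu) \<Rightarrow> nat \<Rightarrow> nat \<Rightarrow> 'o \<Rightarrow> (real^'ny) option" where
  "obs1 E w u i d \<omega> =
     (if w i d = 1
      then Some (sensor E d (trajectory E u (param E \<omega>) (obs_time E i)) + noise E i d \<omega>)
      else None)"

definition obs_at ::
    "('nx::finite, 'nu::finite, 'nt::finite, 'ny::finite, 'o) exp_model \<Rightarrow>
     (nat \<Rightarrow> nat \<Rightarrow> nat) \<Rightarrow> (real \<Rightarrow> real^'nu) \<Rightarrow> nat \<Rightarrow> 'o \<Rightarrow> nat \<Rightarrow> (real^'ny) option" where
  "obs_at E w u i \<omega> = (\<lambda>d\<in>{1..num_sensors E}. obs1 E w u i d \<omega>)"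

definition obs ::
    "('nx::finite, 'nu::finite, 'nt::finite, 'ny::finite, 'o) exp_model \<Rightarrow>
     (nat \<Rightarrow> nat \<Rightarrow> nat) \<Rightarrow> (real \<Rightarrow> real^'nu) \<Rightarrow> 'o \<Rightarrow> nat \<Rightarrow> nat \<Rightarrow> (real^'ny) option" where
  "obs E w u \<omega> = (\<lambda>i\<in>{1..num_times E}. obs_at E w u i \<omega>)"

text \<open>
  The reference measure for single observations: Lebesgue measure on the proper values and a unit
  mass at the cemetery value.
\<close>

definition obs_measure :: "(real^'ny::finite) option measure" where
  "obs_measure = measure_of UNIV {A. Some -` A \<in> sets borel}
     (\<lambda>A. emeasure lborel (Some -` A) + indicator A None)"

definition obs_at_measure ::
    "('nx::finite, 'nu::finite, 'nt::finite, 'ny::finite, 'o) exp_model \<Rightarrow>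
     (nat \<Rightarrow> (real^'ny) option) measure" where
  "obs_at_measure E = PiM {1..num_sensors E} (\<lambda>_. obs_measure)"

definition obs_vec_measure ::
    "('nx::finite, 'nu::finite, 'nt::finite, 'ny::finite, 'o) exp_model \<Rightarrow>
     (nat \<Rightarrow> nat \<Rightarrow> (real^'ny) option) measure" where
  "obs_vec_measure E = PiM {1..num_times E} (\<lambda>_. obs_at_measure E)"

text \<open>
  Conditional densities \<open>p(y\<^sub>i\<^sub>,\<^sub>d|\<theta>,w,u)\<close>, \<open>p(y\<^sub>i|\<theta>,w,u)\<close>, \<open>p(y|\<theta>,w,u)\<close> with respect to these
  measures. That they are the densities of the observations defined above is the content of
  \<open>distributed_param_obs_at\<close> and \<open>distributed_param_obs\<close> below.
\<close>

definition lik1 ::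
    "('nx::finite, 'nu::finite, 'nt::finite, 'ny::finite, 'o) exp_model \<Rightarrow>
     (nat \<Rightarrow> nat \<Rightarrow> nat) \<Rightarrow> (real \<Rightarrow> real^'nu) \<Rightarrow> nat \<Rightarrow> nat \<Rightarrow> real^'nt \<Rightarrow> (real^'ny) option \<Rightarrow> real" where
  "lik1 E w u i d \<theta> z =
     (if w i d = 1
      then (case z of None \<Rightarrow> 0
            | Some v \<Rightarrow> noise_density E i d (v - sensor E d (trajectory E u \<theta> (obs_time E i))))
      else (case z of None \<Rightarrow> 1 | Some v \<Rightarrow> 0))"

definition lik_at ::
    "('nx::finite, 'nu::finite, 'nt::finite, 'ny::finite, 'o) exp_model \<Rightarrow>
     (nat \<Rightarrow> nat \<Rightarrow> nat) \<Rightarrow> (real \<Rightarrow> real^'nu) \<Rightarrow> nat \<Rightarrow> real^'nt \<Rightarrow> (nat \<Rightarrow> (real^'ny) option) \<Rightarrow> real" where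
  "lik_at E w u i \<theta> yi = (\<Prod>d\<in>{1..num_sensors E}. lik1 E w u i d \<theta> (yi d))"

definition lik ::
    "('nx::finite, 'nu::finite, 'nt::finite, 'ny::finite, 'o) exp_model \<Rightarrow>
     (nat \<Rightarrow> nat \<Rightarrow> nat) \<Rightarrow> (real \<Rightarrow> real^'nu) \<Rightarrow> real^'nt \<Rightarrow> (nat \<Rightarrow> nat \<Rightarrow> (real^'ny) option) \<Rightarrow> real" where
  "lik E w u \<theta> y = (\<Prod>i\<in>{1..num_times E}. lik_at E w u i \<theta> (y i))"

definition marg_at ::
    "('nx::finite, 'nu::finite, 'nt::finite, 'ny::finite, 'o) exp_model \<Rightarrow>
     (nat \<Rightarrow> nat \<Rightarrow> nat) \<Rightarrow> (real \<Rightarrow> real^'nu) \<Rightarrow> nat \<Rightarrow> (nat \<Rightarrow> (real^'ny) option) \<Rightarrow> real" where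
  "marg_at E w u i yi = (\<integral>\<theta>. lik_at E w u i \<theta> yi * prior E \<theta> \<partial>lborel)"

definition marg ::
    "('nx::finite, 'nu::finite, 'nt::finite, 'ny::finite, 'o) exp_model \<Rightarrow>
     (nat \<Rightarrow> nat \<Rightarrow> nat) \<Rightarrow> (real \<Rightarrow> real^'nu) \<Rightarrow> (nat \<Rightarrow> nat \<Rightarrow> (real^'ny) option) \<Rightarrow> real" where
  "marg E w u y = (\<integral>\<theta>. lik E w u \<theta> y * prior E \<theta> \<partial>lborel)"

text \<open>
  Expectations are taken on the underlying probability space; the joint laws of \<open>(\<theta>, y\<^sub>i)\<close> and
  \<open>(\<theta>, y)\<close> there have densities \<open>p\<^sub>0(\<theta>) p(y\<^sub>i|\<theta>,w,u)\<close> and \<open>p\<^sub>0(\<theta>) p(y|\<theta>,w,u)\<close>.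
\<close>

definition inst_info_density ::
    "('nx::finite, 'nu::finite, 'nt::finite, 'ny::finite, 'o) exp_model \<Rightarrow>
     (nat \<Rightarrow> nat \<Rightarrow> nat) \<Rightarrow> (real \<Rightarrow> real^'nu) \<Rightarrow> nat \<Rightarrow> 'o \<Rightarrow> real" where
  "inst_info_density E w u i \<omega> =
     ln (lik_at E w u i (param E \<omega>) (obs_at E w u i \<omega>)) - ln (marg_at E w u i (obs_at E w u i \<omega>))"

definition I_inst ::
    "('nx::finite, 'nu::finite, 'nt::finite, 'ny::finite, 'o) exp_model \<Rightarrow>
     (nat \<Rightarrow> nat \<Rightarrow> nat) \<Rightarrow> (real \<Rightarrow> real^'nu) \<Rightarrow> nat \<Rightarrow> real" where
  "I_inst E w u i = (\<integral>\<omega>. inst_info_density E w u i \<omega> \<partial>sample_space E)"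

definition J_inst ::
    "('nx::finite, 'nu::finite, 'nt::finite, 'ny::finite, 'o) exp_model \<Rightarrow>
     (nat \<Rightarrow> nat \<Rightarrow> nat) \<Rightarrow> (real \<Rightarrow> real^'nu) \<Rightarrow> real" where
  "J_inst E w u = (\<Sum>i\<in>{1..num_times E}. I_inst E w u i)"

definition EIG_density ::
    "('nx::finite, 'nu::finite, 'nt::finite, 'ny::finite, 'o) exp_model \<Rightarrow>
     (nat \<Rightarrow> nat \<Rightarrow> nat) \<Rightarrow> (real \<Rightarrow> real^'nu) \<Rightarrow> 'o \<Rightarrow> real" where
  "EIG_density E w u \<omega> = ln (lik E w u (param E \<omega>) (obs E w u \<omega>) / marg E w u (obs E w u \<omega>))"

definition J_EIG ::
    "('nx::finite, 'nu::finite, 'nt::finite, 'ny::finite, 'o) exp_model \<Rightarrow>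
     (nat \<Rightarrow> nat \<Rightarrow> nat) \<Rightarrow> (real \<Rightarrow> real^'nu) \<Rightarrow> real" where
  "J_EIG E w u = (\<integral>\<omega>. EIG_density E w u \<omega> \<partial>sample_space E)"

text \<open>
  All information quantities are well defined and finite. Without this, the Bochner integrals
  above would silently be \<open>0\<close>.
\<close>

definition finite_information ::
    "('nx::finite, 'nu::finite, 'nt::finite, 'ny::finite, 'o) exp_model \<Rightarrow>
     (nat \<Rightarrow> nat \<Rightarrow> nat) \<Rightarrow> (real \<Rightarrow> real^'nu) \<Rightarrow> bool" where
  "finite_information E w u \<longleftrightarrow>
     (\<forall>i\<in>{1..num_times E}. integrable (sample_space E) (inst_info_density E w u i)) \<and>
     integrable (sample_space E) (EIG_density E w u)"

definition K_time ::
    "('nx::finite, 'nu::finite, 'nt::finite, 'ny::finite, 'o) exp_model \<Rightarrow>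
     (nat \<Rightarrow> nat \<Rightarrow> nat) \<Rightarrow> nat" where
  "K_time E w = card {i \<in> {1..num_times E}. (\<Sum>d\<in>{1..num_sensors E}. w i d) > 0}"

lemma space_obs_measure [simp]: "space obs_measure = UNIV"
  by (simp add: obs_measure_def space_measure_of_conv)

lemma obs_sigma_algebra: "sigma_algebra UNIV {A::(real^'ny::finite) option set. Some -` A \<in> sets borel}"
proof (rule sigma_algebra_iff2[THEN iffD2], safe)
  fix A :: "(real^'ny) option set" assume "Some -` A \<in> sets borel"
  then show "Some -` (UNIV - A) \<in> sets borel"
    by (metis Diff_UNIV Compl_eq_Diff_UNIV borel_comp vimage_Compl)
next
  fix A :: "nat \<Rightarrow> (real^'ny) option set" assume "range A \<subseteq> {A. Some -` A \<in> sets borel}"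
  then have "\<And>n. Some -` A n \<in> sets borel" by auto
  then show "Some -` (\<Union>(range A)) \<in> sets borel"
    by (simp add: vimage_UN sets.countable_UN)
qed simp_all

lemma sets_obs_measure:
  "sets obs_measure = {A::(real^'ny::finite) option set. Some -` A \<in> sets borel}"
  unfolding obs_measure_def
  by (simp add: sigma_algebra.sets_measure_of_eq[OF obs_sigma_algebra])

lemma emeasure_obs_measure:
  assumes "A \<in> sets (obs_measure :: (real^'ny::finite) option measure)"
  shows "emeasure obs_measure A = emeasure lborel (Some -` A) + indicator A None"
proof (rule emeasure_measure_of[OF obs_measure_def])
  show "positive (sets (obs_measure :: (real^'ny) option measure))
     (\<lambda>A. emeasure lborel (Some -` A) + indicator A None)"
    by (simp add: positive_def)
  show "countably_additive (sets (obs_measure :: (real^'ny) option measure))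
     (\<lambda>A. emeasure lborel (Some -` A) + indicator A None)"
  proof (rule countably_additiveI)
    fix A :: "nat \<Rightarrow> (real^'ny) option set"
    assume "range A \<subseteq> sets obs_measure" and dis: "disjoint_family A"
    then have A: "range A \<subseteq> {A. Some -` A \<in> sets borel}" by (simp add: sets_obs_measure)
    have "(\<Sum>n. emeasure lborel (Some -` A n)) = emeasure lborel (\<Union>n. Some -` A n)"
      using A dis by (intro suminf_emeasure) (auto simp: disjoint_family_on_def)
    moreover have "(\<Sum>n. indicator (A n) None :: ennreal) = indicator (\<Union>n. A n) None"
      by (rule suminf_indicator[OF dis])
    ultimately show "(\<Sum>n. emeasure lborel (Some -` A n) + indicator (A n) None)
        = emeasure lborel (Some -` (\<Union>(range A))) + indicator (\<Union>(range A)) None"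
      by (simp add: suminf_add[symmetric] vimage_UN)
  qed
qed (use assms in simp_all)

lemma measurable_Some_obs [measurable]: "Some \<in> borel \<rightarrow>\<^sub>M obs_measure"
  by (rule measurableI) (auto simp: sets_obs_measure)

lemma measurable_obs_iff:
  "f \<in> (obs_measure :: (real^'ny::finite) option measure) \<rightarrow>\<^sub>M N \<longleftrightarrow>
     f None \<in> space N \<and> (\<lambda>v. f (Some v)) \<in> borel \<rightarrow>\<^sub>M N" (is "?L \<longleftrightarrow> ?R")
proof
  assume ?L
  then have [measurable]: "f \<in> obs_measure \<rightarrow>\<^sub>M N" .
  have "f None \<in> space N" using measurable_space[OF \<open>?L\<close>] by simp
  moreover have "(\<lambda>v. f (Some v)) \<in> borel \<rightarrow>\<^sub>M N" by measurable
  ultimately show ?R by simp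
next
  assume R: ?R
  show ?L
  proof (rule measurableI)
    fix z show "f z \<in> space N"
      using R measurable_space[of "\<lambda>v. f (Some v)" borel N] by (cases z) auto
  next
    fix A assume "A \<in> sets N"
    then have "(\<lambda>v. f (Some v)) -` A \<inter> space borel \<in> sets borel"
      using R by (intro measurable_sets) auto
    then show "f -` A \<inter> space obs_measure \<in> sets obs_measure"
      by (simp add: sets_obs_measure vimage_def)
  qed
qed

lemma nn_integral_obs_measure:
  assumes "f \<in> borel_measurable (obs_measure :: (real^'ny::finite) option measure)"
  shows "(\<integral>\<^sup>+z. f z \<partial>obs_measure) = (\<integral>\<^sup>+v. f (Some v) \<partial>lborel) + f None"
  using assms
proof (induction rule: borel_measurable_induct)
  case (cong f g)
  then show ?case by (simp add: fun_eq_iff[symmetric])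
next
  case (set A)
  have "(\<lambda>v. indicator A (Some v) :: ennreal) = indicator (Some -` A)"
    by (auto simp: fun_eq_iff indicator_def)
  moreover have "Some -` A \<in> sets lborel" using set by (simp add: sets_obs_measure)
  ultimately show ?case using set by (simp add: emeasure_obs_measure)
next
  case (mult f c)
  note [measurable] = \<open>f \<in> borel_measurable obs_measure\<close>
  show ?case by (simp add: nn_integral_cmult mult distrib_left)
next
  case (add f g)
  note [measurable] = \<open>f \<in> borel_measurable obs_measure\<close> \<open>g \<in> borel_measurable obs_measure\<close>
  show ?case by (simp add: nn_integral_add add ac_simps)
next
  case (seq U)
  note [measurable] = \<open>\<And>i. U i \<in> borel_measurable obs_measure\<close>
  have inc: "incseq (\<lambda>i v. U i (Some v))" "incseq (\<lambda>i. U i None)"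
    using \<open>incseq U\<close> by (auto simp: incseq_def le_fun_def)
  have "(\<integral>\<^sup>+z. (SUP i. U i) z \<partial>obs_measure) = (\<integral>\<^sup>+z. (SUP i. U i z) \<partial>obs_measure)"
    by (simp add: image_comp)
  also have "\<dots> = (SUP i. \<integral>\<^sup>+z. U i z \<partial>obs_measure)"
    using \<open>incseq U\<close> by (intro nn_integral_monotone_convergence_SUP) auto
  also have "\<dots> = (SUP i. (\<integral>\<^sup>+v. U i (Some v) \<partial>lborel) + U i None)"
    by (simp add: seq)
  also have "\<dots> = (SUP i. \<integral>\<^sup>+v. U i (Some v) \<partial>lborel) + (SUP i. U i None)"
    using inc by (intro ennreal_SUP_add) (auto simp: incseq_def le_fun_def intro!: nn_integral_mono)
  also have "(SUP i. \<integral>\<^sup>+v. U i (Some v) \<partial>lborel) = (\<integral>\<^sup>+v. (SUP i. U i (Some v)) \<partial>lborel)"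
    using inc by (intro nn_integral_monotone_convergence_SUP[symmetric]) auto
  finally show ?case by (simp add: image_comp)
qed

lemma sigma_finite_obs_measure: "sigma_finite_measure (obs_measure :: (real^'ny::finite) option measure)"
proof
  obtain A :: "(real^'ny) set set" where A: "countable A" "A \<subseteq> sets lborel" "\<Union>A = space lborel"
      "\<forall>a\<in>A. emeasure lborel a \<noteq> \<infinity>"
    using lborel.sigma_finite_countable by auto
  let ?B = "insert {None} ((`) Some ` A)"
  have "Some -` ((`) Some a) = a" "Some -` {None} = ({} :: (real^'ny) set)" for a :: "(real^'ny) set"
    by (auto simp: inj_vimage_image_eq)
  then have "countable ?B \<and> ?B \<subseteq> sets obs_measure \<and> \<Union>?B = space obs_measure \<and>
      (\<forall>b\<in>?B. emeasure obs_measure b \<noteq> \<infinity>)"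
    using A
  proof (intro conjI)
    show "\<Union>?B = space obs_measure"
    proof (intro set_eqI iffI)
      fix z :: "(real^'ny) option" show "z \<in> \<Union>?B"
      proof (cases z)
        case (Some v)
        then obtain a where "a \<in> A" "v \<in> a" using A(3) by auto
        then show ?thesis using Some by auto
      qed auto
    qed simp
  qed (auto simp: sets_obs_measure emeasure_obs_measure)
  then show "\<exists>B. countable B \<and> B \<subseteq> sets (obs_measure :: (real^'ny) option measure) \<and>
      \<Union>B = space obs_measure \<and> (\<forall>b\<in>B. emeasure obs_measure b \<noteq> \<infinity>)"
    by blast
qed

lemma PiM_density_finite:
  fixes f :: "'i \<Rightarrow> 'a \<Rightarrow> ennreal"
  assumes I: "finite I" and M: "\<And>i. sigma_finite_measure (M i)"
    and f: "\<And>i. i \<in> I \<Longrightarrow> f i \<in> borel_measurable (M i)"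
    and D: "\<And>i. i \<in> I \<Longrightarrow> prob_space (density (M i) (f i))"
  shows "PiM I (\<lambda>i. density (M i) (f i)) = density (PiM I M) (\<lambda>x. \<Prod>i\<in>I. f i (x i))"
proof -
  define N where "N i = (if i \<in> I then density (M i) (f i) else M i)" for i
  have sN: "sigma_finite_measure (N i)" for i
    using M D by (auto simp: N_def intro: prob_space_imp_sigma_finite)
  interpret M: product_sigma_finite M by (simp add: product_sigma_finite_def M)
  interpret N: product_sigma_finite N by (simp add: product_sigma_finite_def sN)
  note f[measurable]
  have meas: "(\<lambda>x. \<Prod>i\<in>I. f i (x i)) \<in> borel_measurable (PiM I M)"
    by measurable
  have "density (PiM I M) (\<lambda>x. \<Prod>i\<in>I. f i (x i)) = PiM I N"
  proof (rule N.PiM_eqI[OF I])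
    show "sets (density (PiM I M) (\<lambda>x. \<Prod>i\<in>I. f i (x i))) = sets (PiM I N)"
      by (simp add: N_def cong: sets_PiM_cong)
    fix A assume "\<And>i. i \<in> I \<Longrightarrow> A i \<in> sets (N i)"
    then have A[measurable]: "\<And>i. i \<in> I \<Longrightarrow> A i \<in> sets (M i)" by (simp add: N_def)
    have PA: "Pi\<^sub>E I A \<in> sets (PiM I M)" using A I by (intro sets_PiM_I_finite) auto
    have "emeasure (density (PiM I M) (\<lambda>x. \<Prod>i\<in>I. f i (x i))) (Pi\<^sub>E I A)
        = (\<integral>\<^sup>+x. (\<Prod>i\<in>I. f i (x i)) * indicator (Pi\<^sub>E I A) x \<partial>PiM I M)"
      by (rule emeasure_density[OF meas PA])
    also have "\<dots> = (\<integral>\<^sup>+x. (\<Prod>i\<in>I. f i (x i) * indicator (A i) (x i)) \<partial>PiM I M)"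
    proof (rule nn_integral_cong)
      fix x assume "x \<in> space (PiM I M)"
      then have "indicator (Pi\<^sub>E I A) x = (\<Prod>i\<in>I. indicator (A i) (x i) :: ennreal)"
        using I by (auto simp: indicator_def space_PiM PiE_iff)
      then show "(\<Prod>i\<in>I. f i (x i)) * indicator (Pi\<^sub>E I A) x = (\<Prod>i\<in>I. f i (x i) * indicator (A i) (x i))"
        by (simp add: prod.distrib)
    qed
    also have "\<dots> = (\<Prod>i\<in>I. \<integral>\<^sup>+x. f i x * indicator (A i) x \<partial>M i)"
      using I by (intro M.product_nn_integral_prod) auto
    also have "\<dots> = (\<Prod>i\<in>I. emeasure (N i) (A i))"
      using A f by (intro prod.cong) (auto simp: N_def emeasure_density)
    finally show "emeasure (density (PiM I M) (\<lambda>x. \<Prod>i\<in>I. f i (x i))) (Pi\<^sub>E I A)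
        = (\<Prod>i\<in>I. emeasure (N i) (A i))" .
  qed
  also have "PiM I N = PiM I (\<lambda>i. density (M i) (f i))"
    by (rule PiM_cong) (auto simp: N_def)
  finally show ?thesis by simp
qed

lemma obs_densities_prelim:
  fixes E :: "('nx::finite, 'nu::finite, 'nt::finite, 'ny::finite, 'o) exp_model"
  assumes E: "controlled_experiment E" and ne: "1 \<le> num_times E" "1 \<le> num_sensors E"
    and R: "sigma_finite_measure R"
    and G: "(\<lambda>(\<theta>, e). G \<theta> e) \<in>
      borel \<Otimes>\<^sub>M PiM ({1..num_times E} \<times> {1..num_sensors E}) (\<lambda>_. borel) \<rightarrow>\<^sub>M R"
    and l: "(\<lambda>(\<theta>, y). l \<theta> y) \<in> borel_measurable (borel \<Otimes>\<^sub>M R)"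
    and l0: "\<And>\<theta> y. 0 \<le> l \<theta> y"
    and eq: "\<And>\<theta>. distr (PiM ({1..num_times E} \<times> {1..num_sensors E})
        (\<lambda>p. density lborel (\<lambda>v. ennreal (noise_density E (fst p) (snd p) v)))) R (G \<theta>)
      = density R (\<lambda>y. ennreal (l \<theta> y))"
  shows "distributed (sample_space E) (lborel \<Otimes>\<^sub>M R)
    (\<lambda>\<omega>. (param E \<omega>, G (param E \<omega>) (noise_vec E \<omega>))) (\<lambda>(\<theta>, y). ennreal (prior E \<theta> * l \<theta> y))"
proof -
  define P where "P = {1..num_times E} \<times> {1..num_sensors E}"
  define \<nu> where "\<nu> p = density lborel (\<lambda>v. ennreal (noise_density E (fst p) (snd p) v))" for p
  define B where "B = (PiM P (\<lambda>_. borel) :: (nat \<times> nat \<Rightarrow> real^'ny) measure)"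
  note G = G[folded P_def, folded B_def]
  note eq = eq[folded P_def, folded \<nu>_def]
  note [measurable] = G l
  interpret prob_space "sample_space E" using E by (simp add: controlled_experiment_def)
  interpret R: sigma_finite_measure R by (rule R)
  have P: "finite P" "P \<noteq> {}" using ne by (auto simp: P_def)
  have par: "distributed (sample_space E) lborel (param E) (\<lambda>\<theta>. ennreal (prior E \<theta>))"
    using E by (simp add: controlled_experiment_def)
  have p0: "0 \<le> prior E \<theta>" for \<theta> using E by (simp add: controlled_experiment_def)
  have nd: "distributed (sample_space E) lborel (noise E (fst p) (snd p))
      (\<lambda>v. ennreal (noise_density E (fst p) (snd p) v))" if "p \<in> P" for p
    using E that by (auto simp: controlled_experiment_def P_def)
  have nm: "noise E (fst p) (snd p) \<in> sample_space E \<rightarrow>\<^sub>M borel" if "p \<in> P" for p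
    using distributed_measurable[OF nd[OF that]] by simp
  have pm [measurable]: "param E \<in> sample_space E \<rightarrow>\<^sub>M borel"
    using distributed_measurable[OF par] by simp
  have prm [measurable]: "(\<lambda>\<theta>. ennreal (prior E \<theta>)) \<in> borel_measurable borel"
    using par by (simp add: distributed_def)
  have nvm [measurable]: "noise_vec E \<in> sample_space E \<rightarrow>\<^sub>M B"
    unfolding noise_vec_def[abs_def] B_def P_def[symmetric]
    by (intro measurable_restrict nm) simp
  have \<nu>: "distr (sample_space E) borel (noise E (fst p) (snd p)) = \<nu> p" if "p \<in> P" for p
    using nd[OF that] by (simp add: distributed_def \<nu>_def cong: distr_cong)
  have "indep_vars (\<lambda>_. borel) (\<lambda>p. noise E (fst p) (snd p)) P"
    using E by (simp add: controlled_experiment_def P_def case_prod_beta')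
  then have "distr (sample_space E) (PiM P (\<lambda>_. borel)) (\<lambda>\<omega>. \<lambda>p\<in>P. noise E (fst p) (snd p) \<omega>)
      = PiM P (\<lambda>p. distr (sample_space E) borel (noise E (fst p) (snd p)))"
    by (subst (asm) indep_vars_iff_distr_eq_PiM'[OF P(2)]) (use nm in auto)
  also have "\<dots> = PiM P \<nu>" by (rule PiM_cong) (simp_all add: \<nu>)
  finally have dn: "distr (sample_space E) B (noise_vec E) = PiM P \<nu>"
    unfolding B_def noise_vec_def[abs_def] P_def[symmetric] .
  have dp: "distr (sample_space E) borel (param E) = density lborel (\<lambda>\<theta>. ennreal (prior E \<theta>))"
    using par by (simp add: distributed_def cong: distr_cong)
  have sn: "sets (PiM P \<nu>) = sets B" unfolding B_def by (rule sets_PiM_cong) (simp_all add: \<nu>_def)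
  have ind: "indep_set {param E -` A \<inter> space (sample_space E) | A. A \<in> sets borel}
       {noise_vec E -` C \<inter> space (sample_space E) | C. C \<in> sets B}"
    using E by (simp add: controlled_experiment_def B_def P_def)
  interpret dP: prob_space "distr (sample_space E) borel (param E)" by (rule prob_space_distr) simp
  interpret dN: prob_space "distr (sample_space E) B (noise_vec E)" by (rule prob_space_distr) simp
  have joint: "distr (sample_space E) borel (param E) \<Otimes>\<^sub>M distr (sample_space E) B (noise_vec E)
      = distr (sample_space E) (borel \<Otimes>\<^sub>M B) (\<lambda>\<omega>. (param E \<omega>, noise_vec E \<omega>))"
  proof (rule pair_measure_eqI)
    show "sigma_finite_measure (distr (sample_space E) borel (param E))" ..
    show "sigma_finite_measure (distr (sample_space E) B (noise_vec E))" ..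
    fix A C assume "A \<in> sets (distr (sample_space E) borel (param E))"
      "C \<in> sets (distr (sample_space E) B (noise_vec E))"
    then have [measurable]: "A \<in> sets borel" "C \<in> sets B" by auto
    have "prob ((param E -` A \<inter> space (sample_space E)) \<inter> (noise_vec E -` C \<inter> space (sample_space E)))
       = prob (param E -` A \<inter> space (sample_space E)) * prob (noise_vec E -` C \<inter> space (sample_space E))"
      by (rule indep_setD[OF ind]) (use \<open>A \<in> sets borel\<close> \<open>C \<in> sets B\<close> in blast)+
    moreover have "(\<lambda>\<omega>. (param E \<omega>, noise_vec E \<omega>)) -` (A \<times> C) \<inter> space (sample_space E)
       = (param E -` A \<inter> space (sample_space E)) \<inter> (noise_vec E -` C \<inter> space (sample_space E))"
      by auto
    ultimately show "emeasure (distr (sample_space E) borel (param E)) A *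
        emeasure (distr (sample_space E) B (noise_vec E)) C =
        emeasure (distr (sample_space E) (borel \<Otimes>\<^sub>M B) (\<lambda>\<omega>. (param E \<omega>, noise_vec E \<omega>))) (A \<times> C)"
      by (simp add: emeasure_distr emeasure_eq_measure ennreal_mult')
  qed simp
  have Gt: "G \<theta> \<in> PiM P \<nu> \<rightarrow>\<^sub>M R" for \<theta>
  proof -
    have "(\<lambda>e. (\<lambda>(\<theta>, e). G \<theta> e) (\<theta>, e)) \<in> B \<rightarrow>\<^sub>M R" by measurable
    then show ?thesis by (simp add: measurable_cong_sets[OF sn refl])
  qed
  have lt [measurable]: "(\<lambda>y. l \<theta> y) \<in> borel_measurable R" for \<theta>
  proof -
    have "(\<lambda>y. (\<lambda>(\<theta>, e). l \<theta> e) (\<theta>, y)) \<in> borel_measurable R" by measurable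
    then show ?thesis by simp
  qed
  have Gm: "(\<lambda>(\<theta>, e). (\<theta>, G \<theta> e)) \<in> borel \<Otimes>\<^sub>M B \<rightarrow>\<^sub>M lborel \<Otimes>\<^sub>M R"
  proof -
    have "(\<lambda>x. (fst x, (\<lambda>(\<theta>, e). G \<theta> e) x)) \<in> borel \<Otimes>\<^sub>M B \<rightarrow>\<^sub>M borel \<Otimes>\<^sub>M R" by measurable
    also have "(\<lambda>x. (fst x, (\<lambda>(\<theta>, e). G \<theta> e) x)) = (\<lambda>(\<theta>, e). (\<theta>, G \<theta> e))" by auto
    finally show ?thesis by (simp cong: measurable_cong_sets sets_pair_measure_cong)
  qed
  have dm: "(\<lambda>(\<theta>, y). ennreal (prior E \<theta> * l \<theta> y)) \<in> borel_measurable (lborel \<Otimes>\<^sub>M R)"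
  proof -
    have "(\<lambda>x. ennreal (prior E (fst x)) * ennreal ((\<lambda>(\<theta>, y). l \<theta> y) x))
       \<in> borel_measurable (borel \<Otimes>\<^sub>M R)" by measurable
    also have "(\<lambda>x. ennreal (prior E (fst x)) * ennreal ((\<lambda>(\<theta>, y). l \<theta> y) x))
       = (\<lambda>(\<theta>, y). ennreal (prior E \<theta> * l \<theta> y))"
      using p0 l0 by (auto simp: ennreal_mult)
    finally show ?thesis by (simp cong: measurable_cong_sets sets_pair_measure_cong)
  qed
  have meas: "(\<lambda>\<omega>. (param E \<omega>, G (param E \<omega>) (noise_vec E \<omega>))) \<in> sample_space E \<rightarrow>\<^sub>M lborel \<Otimes>\<^sub>M R"
  proof -
    have "(\<lambda>\<omega>. (param E \<omega>, noise_vec E \<omega>)) \<in> sample_space E \<rightarrow>\<^sub>M borel \<Otimes>\<^sub>M B" by measurable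
    from measurable_comp[OF this Gm] show ?thesis by (simp add: comp_def)
  qed
  have "distr (sample_space E) (lborel \<Otimes>\<^sub>M R) (\<lambda>\<omega>. (param E \<omega>, G (param E \<omega>) (noise_vec E \<omega>)))
      = density (lborel \<Otimes>\<^sub>M R) (\<lambda>(\<theta>, y). ennreal (prior E \<theta> * l \<theta> y))"
  proof (rule measure_eqI)
    fix A assume "A \<in> sets (distr (sample_space E) (lborel \<Otimes>\<^sub>M R)
        (\<lambda>\<omega>. (param E \<omega>, G (param E \<omega>) (noise_vec E \<omega>))))"
    then have A': "A \<in> sets (lborel \<Otimes>\<^sub>M R)" by simp
    then have A [measurable]: "A \<in> sets (borel \<Otimes>\<^sub>M R)"
      by (simp cong: sets_pair_measure_cong)
    interpret N: prob_space "PiM P \<nu>" using dN.prob_space_axioms by (simp add: dn)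
    have "(\<lambda>(\<theta>, e). G \<theta> e) \<in> borel \<Otimes>\<^sub>M PiM P \<nu> \<rightarrow>\<^sub>M R"
      using G by (simp add: sn cong: measurable_cong_sets sets_pair_measure_cong)
    then have [measurable]: "(\<lambda>x. G (fst x) (snd x)) \<in> borel \<Otimes>\<^sub>M PiM P \<nu> \<rightarrow>\<^sub>M R"
      by (simp add: case_prod_beta')
    note Gt[measurable]
    have ind_m: "(\<lambda>x. indicator A (fst x, G (fst x) (snd x)) :: ennreal)
        \<in> borel_measurable (density lborel (\<lambda>\<theta>. ennreal (prior E \<theta>)) \<Otimes>\<^sub>M PiM P \<nu>)"
    proof -
      have "(\<lambda>x. indicator A (fst x, G (fst x) (snd x)) :: ennreal)
        \<in> borel_measurable (borel \<Otimes>\<^sub>M PiM P \<nu>)" by measurable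
      then show ?thesis by (simp cong: measurable_cong_sets sets_pair_measure_cong)
    qed
    have sec: "{y \<in> space R. (\<theta>, y) \<in> A} \<in> sets R" for \<theta>
    proof -
      have "Pair \<theta> -` A \<in> sets R" by (rule sets_Pair1[OF A])
      moreover have "Pair \<theta> -` A = {y \<in> space R. (\<theta>, y) \<in> A}"
        using sets.sets_into_space[OF A] by (auto simp: space_pair_measure)
      ultimately show ?thesis by simp
    qed
    have hm: "(\<lambda>x. indicator A (fst x, G (fst x) (snd x)) :: ennreal) \<in> borel_measurable (borel \<Otimes>\<^sub>M B)"
    proof -
      have "(\<lambda>x. indicator A ((\<lambda>(\<theta>, e). (\<theta>, G \<theta> e)) x) :: ennreal) \<in> borel_measurable (borel \<Otimes>\<^sub>M B)"
        by (rule measurable_compose[OF Gm]) (use A' in simp)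
      then show ?thesis by (simp add: case_prod_beta')
    qed
    have "emeasure (distr (sample_space E) (lborel \<Otimes>\<^sub>M R)
          (\<lambda>\<omega>. (param E \<omega>, G (param E \<omega>) (noise_vec E \<omega>)))) A
        = (\<integral>\<^sup>+x. indicator A x \<partial>distr (sample_space E) (lborel \<Otimes>\<^sub>M R)
          (\<lambda>\<omega>. (param E \<omega>, G (param E \<omega>) (noise_vec E \<omega>))))"
      using A' by simp
    also have "\<dots> = (\<integral>\<^sup>+\<omega>. indicator A (param E \<omega>, G (param E \<omega>) (noise_vec E \<omega>)) \<partial>sample_space E)"
      by (rule nn_integral_distr[OF meas]) (use A' in simp)
    also have "\<dots> = (\<integral>\<^sup>+x. indicator A (fst x, G (fst x) (snd x))
        \<partial>distr (sample_space E) (borel \<Otimes>\<^sub>M B) (\<lambda>\<omega>. (param E \<omega>, noise_vec E \<omega>)))"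
      by (subst nn_integral_distr) (use hm in simp_all)
    also have "\<dots> = (\<integral>\<^sup>+\<theta>. \<integral>\<^sup>+e. indicator A (\<theta>, G \<theta> e) \<partial>PiM P \<nu> \<partial>density lborel (\<lambda>\<theta>. ennreal (prior E \<theta>)))"
      unfolding joint[symmetric] dn dp using N.nn_integral_fst[OF ind_m] by simp
    also have "\<dots> = (\<integral>\<^sup>+\<theta>. ennreal (prior E \<theta>) * (\<integral>\<^sup>+e. indicator A (\<theta>, G \<theta> e) \<partial>PiM P \<nu>) \<partial>lborel)"
    proof (rule nn_integral_density)
      have "(\<lambda>\<theta>. \<integral>\<^sup>+e. indicator A (fst (\<theta>, e), G (fst (\<theta>, e)) (snd (\<theta>, e))) \<partial>PiM P \<nu>)
          \<in> borel_measurable (density lborel (\<lambda>\<theta>. ennreal (prior E \<theta>)))"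
        by (rule N.borel_measurable_nn_integral_fst[OF ind_m])
      then show "(\<lambda>\<theta>. \<integral>\<^sup>+e. indicator A (\<theta>, G \<theta> e) \<partial>PiM P \<nu>) \<in> borel_measurable lborel"
        by simp
    qed simp
    also have "\<dots> = (\<integral>\<^sup>+\<theta>. ennreal (prior E \<theta>) * (\<integral>\<^sup>+y. ennreal (l \<theta> y) * indicator A (\<theta>, y) \<partial>R) \<partial>lborel)"
    proof (intro nn_integral_cong arg_cong2[where f="(*)"] refl)
      fix \<theta>
      have im: "(\<lambda>y. indicator A (\<theta>, y) :: ennreal) \<in> borel_measurable R"
        by measurable
      have "(\<integral>\<^sup>+e. indicator A (\<theta>, G \<theta> e) \<partial>PiM P \<nu>) = (\<integral>\<^sup>+y. indicator A (\<theta>, y) \<partial>distr (PiM P \<nu>) R (G \<theta>))"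
        by (rule nn_integral_distr[symmetric, OF Gt]) (use im in simp)
      also have "\<dots> = (\<integral>\<^sup>+y. ennreal (l \<theta> y) * indicator A (\<theta>, y) \<partial>R)"
        unfolding eq by (rule nn_integral_density) (use im in auto)
      finally show "(\<integral>\<^sup>+e. indicator A (\<theta>, G \<theta> e) \<partial>PiM P \<nu>) = \<dots>" .
    qed
    also have "\<dots> = (\<integral>\<^sup>+\<theta>. \<integral>\<^sup>+y. ennreal (prior E \<theta> * l \<theta> y) * indicator A (\<theta>, y) \<partial>R \<partial>lborel)"
    proof (intro nn_integral_cong)
      fix \<theta>
      have "(\<lambda>y. ennreal (l \<theta> y) * indicator A (\<theta>, y)) \<in> borel_measurable R" by measurable
      then show "ennreal (prior E \<theta>) * (\<integral>\<^sup>+y. ennreal (l \<theta> y) * indicator A (\<theta>, y) \<partial>R)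
          = (\<integral>\<^sup>+y. ennreal (prior E \<theta> * l \<theta> y) * indicator A (\<theta>, y) \<partial>R)"
        using p0 l0 by (simp add: nn_integral_cmult[symmetric] ennreal_mult mult.assoc)
    qed
    also have "\<dots> = (\<integral>\<^sup>+x. (\<lambda>(\<theta>, y). ennreal (prior E \<theta> * l \<theta> y)) x * indicator A x \<partial>(lborel \<Otimes>\<^sub>M R))"
      by (subst R.nn_integral_fst[symmetric]) (use dm A' in auto)
    also have "\<dots> = emeasure (density (lborel \<Otimes>\<^sub>M R) (\<lambda>(\<theta>, y). ennreal (prior E \<theta> * l \<theta> y))) A"
      by (rule emeasure_density[symmetric, OF dm A'])
    finally show "emeasure (distr (sample_space E) (lborel \<Otimes>\<^sub>M R)
          (\<lambda>\<omega>. (param E \<omega>, G (param E \<omega>) (noise_vec E \<omega>)))) A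
        = emeasure (density (lborel \<Otimes>\<^sub>M R) (\<lambda>(\<theta>, y). ennreal (prior E \<theta> * l \<theta> y))) A" .
  qed simp
  then show ?thesis using dm meas by (simp add: distributed_def)
qed

lemma lik1_measurable:
  fixes E :: "('nx::finite, 'nu::finite, 'nt::finite, 'ny::finite, 'o) exp_model"
  assumes E: "controlled_experiment E" and u: "u \<in> controls E"
    and i: "i \<in> {1..num_times E}" and d: "d \<in> {1..num_sensors E}"
  shows "(\<lambda>(\<theta>, z). lik1 E w u i d \<theta> z) \<in> borel_measurable (borel \<Otimes>\<^sub>M obs_measure)"
proof -
  define h where "h \<theta> = sensor E d (trajectory E u \<theta> (obs_time E i))" for \<theta>
  have [measurable]: "h \<in> borel_measurable borel"
    unfolding h_def[abs_def] using E u i d unfolding controlled_experiment_def by blast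
  have nn: "0 \<le> noise_density E i d v" for v
    using E i d by (auto simp: controlled_experiment_def)
  have "distributed (sample_space E) lborel (noise E i d) (\<lambda>v. ennreal (noise_density E i d v))"
    using E i d unfolding controlled_experiment_def by blast
  then have "(\<lambda>v. ennreal (noise_density E i d v)) \<in> borel_measurable lborel"
    unfolding distributed_def by blast
  then have "(\<lambda>v. enn2real (ennreal (noise_density E i d v))) \<in> borel_measurable borel"
    by simp
  then have nm [measurable]: "noise_density E i d \<in> borel_measurable borel"
    using nn by simp
  have isN: "Measurable.pred ((borel :: (real^'nt) measure) \<Otimes>\<^sub>M (obs_measure :: (real^'ny) option measure))
      (\<lambda>x. snd x = None)"
  proof -
    have "Measurable.pred obs_measure (\<lambda>z::(real^'ny) option. z = None)"
      by (subst measurable_obs_iff) simp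
    from measurable_compose[OF measurable_snd this] show ?thesis .
  qed
  define g :: "(real^'ny) option \<Rightarrow> real^'ny" where "g = the"
  have gm: "g \<in> borel_measurable obs_measure"
    by (subst measurable_obs_iff) (simp add: g_def)
  have [measurable]: "(\<lambda>x. g (snd x)) \<in>
      borel_measurable ((borel :: (real^'nt) measure) \<Otimes>\<^sub>M (obs_measure :: (real^'ny) option measure))"
    by (rule measurable_compose[OF measurable_snd gm])
  note isN[measurable]
  have "(\<lambda>x. if w i d = 1 then (if snd x = None then 0 else noise_density E i d (g (snd x) - h (fst x)))
        else (if snd x = None then 1 else 0))
      \<in> borel_measurable ((borel :: (real^'nt) measure) \<Otimes>\<^sub>M (obs_measure :: (real^'ny) option measure))"
    by (cases "w i d = 1") (simp_all, measurable)
  also have "(\<lambda>x. if w i d = 1 then (if snd x = None then 0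
          else noise_density E i d (g (snd x) - h (fst x)))
        else (if snd x = None then 1 else 0)) = (\<lambda>(\<theta>, z). lik1 E w u i d \<theta> z)"
    by (auto simp: fun_eq_iff lik1_def h_def g_def split: option.splits)
  finally show ?thesis .
qed

lemma lik1_nonneg:
  assumes "controlled_experiment E" "i \<in> {1..num_times E}" "d \<in> {1..num_sensors E}"
  shows "0 \<le> lik1 E w u i d \<theta> z"
  using assms by (auto simp: lik1_def controlled_experiment_def split: option.splits)

lemma lik_at_nonneg:
  assumes "controlled_experiment E" "i \<in> {1..num_times E}"
  shows "0 \<le> lik_at E w u i \<theta> yi"
  unfolding lik_at_def using assms by (intro prod_nonneg ballI lik1_nonneg) auto

lemma lik_nonneg: "controlled_experiment E \<Longrightarrow> 0 \<le> lik E w u \<theta> y"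
  unfolding lik_def by (intro prod_nonneg ballI lik_at_nonneg) auto

lemma lik_at_measurable:
  assumes "controlled_experiment E" "u \<in> controls E" "i \<in> {1..num_times E}"
  shows "(\<lambda>(\<theta>, yi). lik_at E w u i \<theta> yi) \<in> borel_measurable (borel \<Otimes>\<^sub>M obs_at_measure E)"
proof -
  have "(\<lambda>x. (\<lambda>(\<theta>, z). lik1 E w u i d \<theta> z) (fst x, snd x d))
      \<in> borel_measurable (borel \<Otimes>\<^sub>M obs_at_measure E)" if d: "d \<in> {1..num_sensors E}" for d
    by (rule measurable_compose[OF _ lik1_measurable[OF assms d]])
       (unfold obs_at_measure_def, use d in measurable)
  then show ?thesis
    unfolding lik_at_def case_prod_beta' by (intro borel_measurable_prod) auto
qed

lemma lik_measurable:
  assumes "controlled_experiment E" "u \<in> controls E"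
  shows "(\<lambda>(\<theta>, y). lik E w u \<theta> y) \<in> borel_measurable (borel \<Otimes>\<^sub>M obs_vec_measure E)"
proof -
  have "(\<lambda>x. (\<lambda>(\<theta>, z). lik_at E w u i \<theta> z) (fst x, snd x i))
      \<in> borel_measurable (borel \<Otimes>\<^sub>M obs_vec_measure E)" if i: "i \<in> {1..num_times E}" for i
    by (rule measurable_compose[OF _ lik_at_measurable[OF assms i]])
       (unfold obs_vec_measure_def, use i in measurable)
  then show ?thesis
    unfolding lik_def case_prod_beta' by (intro borel_measurable_prod) auto
qed

lemma sigma_finite_obs_at_measure: "sigma_finite_measure (obs_at_measure E)"
proof -
  interpret product_sigma_finite "\<lambda>_. obs_measure"
    by (simp add: product_sigma_finite_def sigma_finite_obs_measure)
  show ?thesis unfolding obs_at_measure_def by (rule sigma_finite) simp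
qed

lemma sigma_finite_obs_vec_measure: "sigma_finite_measure (obs_vec_measure E)"
proof -
  interpret product_sigma_finite "\<lambda>_. obs_at_measure E"
    by (simp add: product_sigma_finite_def sigma_finite_obs_at_measure)
  show ?thesis unfolding obs_vec_measure_def by (rule sigma_finite) simp
qed

text \<open>The observations as functions of the parameter value and the noise vector.\<close>

definition obs1_fun ::
    "('nx::finite, 'nu::finite, 'nt::finite, 'ny::finite, 'o) exp_model \<Rightarrow>
     (nat \<Rightarrow> nat \<Rightarrow> nat) \<Rightarrow> (real \<Rightarrow> real^'nu) \<Rightarrow> nat \<times> nat \<Rightarrow> real^'nt \<Rightarrow> real^'ny \<Rightarrow>
     (real^'ny) option" where
  "obs1_fun E w u p \<theta> v =
     (if w (fst p) (snd p) = 1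
      then Some (sensor E (snd p) (trajectory E u \<theta> (obs_time E (fst p))) + v) else None)"

definition obs_at_fun ::
    "('nx::finite, 'nu::finite, 'nt::finite, 'ny::finite, 'o) exp_model \<Rightarrow>
     (nat \<Rightarrow> nat \<Rightarrow> nat) \<Rightarrow> (real \<Rightarrow> real^'nu) \<Rightarrow> nat \<Rightarrow> real^'nt \<Rightarrow> (nat \<times> nat \<Rightarrow> real^'ny) \<Rightarrow>
     nat \<Rightarrow> (real^'ny) option" where
  "obs_at_fun E w u i \<theta> e = (\<lambda>d\<in>{1..num_sensors E}. obs1_fun E w u (i, d) \<theta> (e (i, d)))"

definition obs_fun ::
    "('nx::finite, 'nu::finite, 'nt::finite, 'ny::finite, 'o) exp_model \<Rightarrow>
     (nat \<Rightarrow> nat \<Rightarrow> nat) \<Rightarrow> (real \<Rightarrow> real^'nu) \<Rightarrow> real^'nt \<Rightarrow> (nat \<times> nat \<Rightarrow> real^'ny) \<Rightarrow>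
     nat \<Rightarrow> nat \<Rightarrow> (real^'ny) option" where
  "obs_fun E w u \<theta> e = (\<lambda>i\<in>{1..num_times E}. obs_at_fun E w u i \<theta> e)"

lemma obs_at_eq:
  "i \<in> {1..num_times E} \<Longrightarrow> obs_at E w u i \<omega> = obs_at_fun E w u i (param E \<omega>) (noise_vec E \<omega>)"
  by (auto simp: obs_at_def obs_at_fun_def obs1_def obs1_fun_def noise_vec_def fun_eq_iff restrict_def)

lemma obs_eq: "obs E w u \<omega> = obs_fun E w u (param E \<omega>) (noise_vec E \<omega>)"
  unfolding obs_def obs_fun_def by (intro restrict_ext obs_at_eq)

context
  fixes E :: "('nx::finite, 'nu::finite, 'nt::finite, 'ny::finite, 'o) exp_model"
    and w :: "nat \<Rightarrow> nat \<Rightarrow> nat" and u :: "real \<Rightarrow> real^'nu"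
    and P :: "(nat \<times> nat) set" and \<nu> :: "nat \<times> nat \<Rightarrow> (real^'ny) measure"
  defines "P \<equiv> {1..num_times E} \<times> {1..num_sensors E}"
    and "\<nu> \<equiv> (\<lambda>p. density lborel (\<lambda>v. ennreal (noise_density E (fst p) (snd p) v)))"
  assumes E: "controlled_experiment E" and u: "u \<in> controls E"
begin

lemma nu_prob: "p \<in> P \<Longrightarrow> prob_space (\<nu> p)"
proof -
  assume p: "p \<in> P"
  interpret prob_space "sample_space E" using E by (simp add: controlled_experiment_def)
  have nd: "distributed (sample_space E) lborel (noise E (fst p) (snd p))
      (\<lambda>v. ennreal (noise_density E (fst p) (snd p) v))"
    using E p by (auto simp: controlled_experiment_def P_def)
  then have "\<nu> p = distr (sample_space E) lborel (noise E (fst p) (snd p))"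
    by (simp add: \<nu>_def distributed_def)
  then show ?thesis
    using distributed_measurable[OF nd] by (simp add: prob_space_distr)
qed

lemma sensor_meas:
  "p \<in> P \<Longrightarrow> (\<lambda>\<theta>. sensor E (snd p) (trajectory E u \<theta> (obs_time E (fst p)))) \<in> borel_measurable borel"
  using E u by (auto simp: controlled_experiment_def P_def)

lemma obs1_fun_meas:
  assumes p: "p \<in> P"
  shows "(\<lambda>(\<theta>, v). obs1_fun E w u p \<theta> v) \<in> borel \<Otimes>\<^sub>M borel \<rightarrow>\<^sub>M obs_measure"
proof -
  note [measurable] = sensor_meas[OF p]
  show ?thesis
  proof (cases "w (fst p) (snd p) = 1")
    case True
    then have "(\<lambda>(\<theta>, v). obs1_fun E w u p \<theta> v) =
      (\<lambda>x. Some (sensor E (snd p) (trajectory E u (fst x) (obs_time E (fst p))) + snd x))"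
      by (auto simp: obs1_fun_def)
    then show ?thesis by simp
  next
    case False
    then have "(\<lambda>(\<theta>, v). obs1_fun E w u p \<theta> v) = (\<lambda>x. None)"
      by (auto simp: obs1_fun_def)
    then show ?thesis by simp
  qed
qed

lemma obs1_fun_law:
  assumes p: "p \<in> P"
  shows "distr (\<nu> p) obs_measure (obs1_fun E w u p \<theta>)
    = density obs_measure (\<lambda>z. ennreal (lik1 E w u (fst p) (snd p) \<theta> z))"
proof (rule measure_eqI)
  define h where "h = sensor E (snd p) (trajectory E u \<theta> (obs_time E (fst p)))"
  interpret prob_space "\<nu> p" by (rule nu_prob[OF p])
  fix A assume "A \<in> sets (distr (\<nu> p) obs_measure (obs1_fun E w u p \<theta>))"
  then have A [measurable]: "A \<in> sets obs_measure" by simp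
  then have SA [measurable]: "Some -` A \<in> sets borel" by (simp add: sets_obs_measure)
  have fm: "obs1_fun E w u p \<theta> \<in> \<nu> p \<rightarrow>\<^sub>M obs_measure"
  proof -
    have "(\<lambda>v. (\<lambda>(\<theta>, v). obs1_fun E w u p \<theta> v) (\<theta>, v)) \<in> borel \<rightarrow>\<^sub>M obs_measure"
      by (rule measurable_compose[OF _ obs1_fun_meas[OF p]]) simp
    then show ?thesis by (simp add: \<nu>_def)
  qed
  have lm: "(\<lambda>z. ennreal (lik1 E w u (fst p) (snd p) \<theta> z)) \<in> borel_measurable obs_measure"
  proof -
    have "(\<lambda>z. (\<lambda>(\<theta>, z). lik1 E w u (fst p) (snd p) \<theta> z) (\<theta>, z)) \<in> borel_measurable obs_measure"
      by (rule measurable_compose[OF _ lik1_measurable[OF E u]]) (use p in \<open>auto simp: P_def\<close>)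
    then show ?thesis by simp
  qed
  have nm [measurable]: "(\<lambda>v. ennreal (noise_density E (fst p) (snd p) v)) \<in> borel_measurable borel"
  proof -
    have "distributed (sample_space E) lborel (noise E (fst p) (snd p))
        (\<lambda>v. ennreal (noise_density E (fst p) (snd p) v))"
      using E p by (auto simp: controlled_experiment_def P_def)
    then have "(\<lambda>v. ennreal (noise_density E (fst p) (snd p) v)) \<in> borel_measurable lborel"
      unfolding distributed_def by blast
    then show ?thesis by simp
  qed
  have R: "emeasure (density obs_measure (\<lambda>z. ennreal (lik1 E w u (fst p) (snd p) \<theta> z))) A
      = (\<integral>\<^sup>+v. ennreal (lik1 E w u (fst p) (snd p) \<theta> (Some v)) * indicator A (Some v) \<partial>lborel)
        + ennreal (lik1 E w u (fst p) (snd p) \<theta> None) * indicator A None"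
    using lm by (simp add: emeasure_density nn_integral_obs_measure)
  show "emeasure (distr (\<nu> p) obs_measure (obs1_fun E w u p \<theta>)) A
      = emeasure (density obs_measure (\<lambda>z. ennreal (lik1 E w u (fst p) (snd p) \<theta> z))) A"
  proof (cases "w (fst p) (snd p) = 1")
    case True
    let ?q = "\<lambda>v. ennreal (noise_density E (fst p) (snd p) v)"
    have pre: "obs1_fun E w u p \<theta> -` A \<inter> space (\<nu> p) = (\<lambda>v. h + v) -` (Some -` A)"
      using True by (auto simp: obs1_fun_def h_def \<nu>_def)
    have "(\<lambda>v. h + v) -` (Some -` A) \<inter> space borel \<in> sets borel"
      by (rule measurable_sets[of _ borel borel]) simp_all
    then have "emeasure (\<nu> p) ((\<lambda>v. h + v) -` (Some -` A))
       = (\<integral>\<^sup>+v. ?q v * indicator (Some -` A) (h + v) \<partial>lborel)"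
      unfolding \<nu>_def by (subst emeasure_density) (auto intro!: nn_integral_cong simp: indicator_def)
    also have "\<dots> = (\<integral>\<^sup>+v. ?q (v - h) * indicator (Some -` A) v \<partial>distr lborel borel ((+) h))"
      by (subst nn_integral_distr) (auto simp: indicator_def)
    also have "\<dots> = (\<integral>\<^sup>+v. ?q (v - h) * indicator (Some -` A) v \<partial>lborel)"
      by (simp add: lborel_distr_plus)
    also have "\<dots> = emeasure (density obs_measure (\<lambda>z. ennreal (lik1 E w u (fst p) (snd p) \<theta> z))) A"
      unfolding R using True
      by (auto simp: lik1_def h_def indicator_def intro!: nn_integral_cong)
    finally show ?thesis using fm A by (simp add: emeasure_distr pre)
  next
    case False
    have pre: "obs1_fun E w u p \<theta> -` A \<inter> space (\<nu> p) = (if None \<in> A then space (\<nu> p) else {})"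
      using False by (auto simp: obs1_fun_def)
    show ?thesis
      unfolding R using False fm A emeasure_space_1 by (simp add: emeasure_distr pre lik1_def)
  qed
qed simp

lemma obs1_fun_meas_nu:
  assumes p: "p \<in> P"
  shows "obs1_fun E w u p \<theta> \<in> \<nu> p \<rightarrow>\<^sub>M obs_measure"
proof -
  have "(\<lambda>v. (\<lambda>(\<theta>, v). obs1_fun E w u p \<theta> v) (\<theta>, v)) \<in> borel \<rightarrow>\<^sub>M obs_measure"
    by (rule measurable_compose[OF _ obs1_fun_meas[OF p]]) simp
  then show ?thesis by (simp add: \<nu>_def)
qed

lemma PiM_nu_prob: "prob_space (PiM P \<nu>)"
  by (intro prob_space_PiM nu_prob)

lemma indep_obs1_fun:
  assumes "P \<noteq> {}"
  shows "prob_space.indep_vars (PiM P \<nu>) (\<lambda>_. obs_measure) (\<lambda>p e. obs1_fun E w u p \<theta> (e p)) P"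
proof -
  interpret prob_space "PiM P \<nu>" by (rule PiM_nu_prob)
  have "distr (PiM P \<nu>) (PiM P \<nu>) (\<lambda>e. \<lambda>p\<in>P. e p) = distr (PiM P \<nu>) (PiM P \<nu>) (\<lambda>e. e)"
    by (rule distr_cong) (auto simp: space_PiM)
  also have "\<dots> = PiM P \<nu>" by (simp add: distr_id2)
  also have "\<dots> = PiM P (\<lambda>p. distr (PiM P \<nu>) (\<nu> p) (\<lambda>e. e p))"
    by (rule PiM_cong[OF refl]) (rule distr_PiM_component[OF nu_prob, symmetric])
  finally have "indep_vars \<nu> (\<lambda>p e. e p) P"
    by (subst indep_vars_iff_distr_eq_PiM'[OF assms]) auto
  then show ?thesis by (rule indep_vars_compose2) (rule obs1_fun_meas_nu)
qed

lemma obs_at_fun_law: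
  assumes i: "i \<in> {1..num_times E}" and ne: "1 \<le> num_sensors E"
  shows "distr (PiM P \<nu>) (obs_at_measure E) (obs_at_fun E w u i \<theta>)
    = density (obs_at_measure E) (\<lambda>yi. ennreal (lik_at E w u i \<theta> yi))"
proof -
  let ?D = "{1..num_sensors E}"
  interpret prob_space "PiM P \<nu>" by (rule PiM_nu_prob)
  have iD: "(i, d) \<in> P" if "d \<in> ?D" for d using that i by (simp add: P_def)
  have cm [measurable]: "(\<lambda>e. obs1_fun E w u (i, d) \<theta> (e (i, d))) \<in> PiM P \<nu> \<rightarrow>\<^sub>M obs_measure"
    if "d \<in> ?D" for d
    by (rule measurable_compose[OF _ obs1_fun_meas_nu[OF iD[OF that]]])
       (use iD[OF that] in measurable)
  have "?D \<noteq> {}" "P \<noteq> {}" using ne i by (auto simp: P_def)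
  have "distr (PiM P \<nu>) (PiM ?D (\<lambda>d. \<nu> (i, d))) (\<lambda>e. \<lambda>d\<in>?D. e (i, d)) = PiM ?D (\<lambda>d. \<nu> (i, d))"
    by (rule distr_PiM_reindex) (auto simp: nu_prob inj_on_def iD)
  have "indep_vars (\<lambda>_. obs_measure) (\<lambda>d e. obs1_fun E w u (i, d) \<theta> (e (i, d))) ?D"
  proof -
    have "indep_vars (\<lambda>d. PiM {(i, d)} (\<lambda>_. obs_measure))
        (\<lambda>d e. \<lambda>p\<in>{(i, d)}. obs1_fun E w u p \<theta> (e p)) ?D"
      by (rule indep_vars_restrict[OF indep_obs1_fun[OF \<open>P \<noteq> {}\<close>]])
         (auto simp: iD disjoint_family_on_def)
    then have "indep_vars (\<lambda>_. obs_measure)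
        (\<lambda>d e. (\<lambda>g. g (i, d)) (\<lambda>p\<in>{(i, d)}. obs1_fun E w u p \<theta> (e p))) ?D"
      by (rule indep_vars_compose2) simp
    then show ?thesis by simp
  qed
  then have "distr (PiM P \<nu>) (PiM ?D (\<lambda>_. obs_measure)) (\<lambda>e. \<lambda>d\<in>?D. obs1_fun E w u (i, d) \<theta> (e (i, d)))
      = PiM ?D (\<lambda>d. distr (PiM P \<nu>) obs_measure (\<lambda>e. obs1_fun E w u (i, d) \<theta> (e (i, d))))"
    by (subst (asm) indep_vars_iff_distr_eq_PiM'[OF \<open>?D \<noteq> {}\<close>]) (use cm in auto)
  also have "\<dots> = PiM ?D (\<lambda>d. density obs_measure (\<lambda>z. ennreal (lik1 E w u i d \<theta> z)))"
  proof (rule PiM_cong[OF refl])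
    fix d assume d: "d \<in> ?D"
    have "distr (PiM P \<nu>) obs_measure (\<lambda>e. obs1_fun E w u (i, d) \<theta> (e (i, d)))
       = distr (distr (PiM P \<nu>) (\<nu> (i, d)) (\<lambda>e. e (i, d))) obs_measure (obs1_fun E w u (i, d) \<theta>)"
      by (subst distr_distr) (use iD[OF d] obs1_fun_meas_nu in \<open>auto simp: comp_def\<close>)
    also have "distr (PiM P \<nu>) (\<nu> (i, d)) (\<lambda>e. e (i, d)) = \<nu> (i, d)"
      by (rule distr_PiM_component[OF nu_prob iD[OF d]])
    finally show "distr (PiM P \<nu>) obs_measure (\<lambda>e. obs1_fun E w u (i, d) \<theta> (e (i, d)))
       = density obs_measure (\<lambda>z. ennreal (lik1 E w u i d \<theta> z))"
      using obs1_fun_law[OF iD[OF d]] by simp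
  qed
  also have "\<dots> = density (PiM ?D (\<lambda>_. obs_measure)) (\<lambda>yi. \<Prod>d\<in>?D. ennreal (lik1 E w u i d \<theta> (yi d)))"
  proof (rule PiM_density_finite)
    fix d assume d: "d \<in> ?D"
    have "(\<lambda>z. (\<lambda>(\<theta>, z). lik1 E w u i d \<theta> z) (\<theta>, z)) \<in> borel_measurable obs_measure"
      by (rule measurable_compose[OF _ lik1_measurable[OF E u i d]]) simp
    then show "(\<lambda>z. ennreal (lik1 E w u i d \<theta> z)) \<in> borel_measurable obs_measure" by simp
    interpret q: prob_space "\<nu> (i, d)" by (rule nu_prob[OF iD[OF d]])
    show "prob_space (density obs_measure (\<lambda>z. ennreal (lik1 E w u i d \<theta> z)))"
      using q.prob_space_distr[OF obs1_fun_meas_nu[OF iD[OF d]]] obs1_fun_law[OF iD[OF d]] by simp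
  qed (simp_all add: sigma_finite_obs_measure)
  also have "(\<lambda>yi. \<Prod>d\<in>?D. ennreal (lik1 E w u i d \<theta> (yi d))) = (\<lambda>yi. ennreal (lik_at E w u i \<theta> yi))"
    unfolding lik_at_def by (intro ext prod_ennreal lik1_nonneg[OF E i]) 
  finally show ?thesis unfolding obs_at_measure_def obs_at_fun_def[abs_def] .
qed

lemma obs_at_fun_meas:
  assumes i: "i \<in> {1..num_times E}"
  shows "(\<lambda>(\<theta>, e). obs_at_fun E w u i \<theta> e) \<in> borel \<Otimes>\<^sub>M PiM P (\<lambda>_. borel) \<rightarrow>\<^sub>M obs_at_measure E"
  unfolding case_prod_beta' obs_at_fun_def obs_at_measure_def
proof (rule measurable_restrict)
  fix d assume "d \<in> {1..num_sensors E}"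
  then have p: "(i, d) \<in> P" using i by (simp add: P_def)
  have "(\<lambda>x. (\<lambda>(\<theta>, v). obs1_fun E w u (i, d) \<theta> v) (fst x, snd x (i, d)))
      \<in> borel \<Otimes>\<^sub>M PiM P (\<lambda>_. borel) \<rightarrow>\<^sub>M obs_measure"
    by (rule measurable_compose[OF _ obs1_fun_meas[OF p]]) (use p in measurable)
  then show "(\<lambda>x. obs1_fun E w u (i, d) (fst x) (snd x (i, d)))
      \<in> borel \<Otimes>\<^sub>M PiM P (\<lambda>_. borel) \<rightarrow>\<^sub>M obs_measure" by simp
qed

lemma obs_fun_meas:
  "(\<lambda>(\<theta>, e). obs_fun E w u \<theta> e) \<in> borel \<Otimes>\<^sub>M PiM P (\<lambda>_. borel) \<rightarrow>\<^sub>M obs_vec_measure E"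
  unfolding case_prod_beta' obs_fun_def obs_vec_measure_def
proof (rule measurable_restrict)
  fix i assume "i \<in> {1..num_times E}"
  from obs_at_fun_meas[OF this]
  show "(\<lambda>x. obs_at_fun E w u i (fst x) (snd x))
      \<in> borel \<Otimes>\<^sub>M PiM P (\<lambda>_. borel) \<rightarrow>\<^sub>M obs_at_measure E" by (simp add: case_prod_beta')
qed

lemma obs_fun_law:
  assumes ne: "1 \<le> num_times E" "1 \<le> num_sensors E"
  shows "distr (PiM P \<nu>) (obs_vec_measure E) (obs_fun E w u \<theta>)
    = density (obs_vec_measure E) (\<lambda>y. ennreal (lik E w u \<theta> y))"
proof -
  let ?D = "{1..num_sensors E}" and ?I = "{1..num_times E}"
  interpret prob_space "PiM P \<nu>" by (rule PiM_nu_prob)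
  have "?I \<noteq> {}" "P \<noteq> {}" using ne by (auto simp: P_def)
  have cm: "obs_at_fun E w u i \<theta> \<in> PiM P \<nu> \<rightarrow>\<^sub>M obs_at_measure E" if i: "i \<in> ?I" for i
  proof -
    have "(\<lambda>e. (\<lambda>(\<theta>, e). obs_at_fun E w u i \<theta> e) (\<theta>, e)) \<in> PiM P (\<lambda>_. borel) \<rightarrow>\<^sub>M obs_at_measure E"
      by (rule measurable_compose[OF _ obs_at_fun_meas[OF i]]) simp
    moreover have "sets (PiM P \<nu>) = sets (PiM P (\<lambda>_. borel))"
      by (rule sets_PiM_cong) (simp_all add: \<nu>_def)
    ultimately show ?thesis by (simp cong: measurable_cong_sets)
  qed
  have "indep_vars (\<lambda>_. obs_at_measure E) (\<lambda>i. obs_at_fun E w u i \<theta>) ?I"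
  proof -
    have "indep_vars (\<lambda>i. PiM ({i} \<times> ?D) (\<lambda>_. obs_measure))
        (\<lambda>i e. \<lambda>p\<in>{i} \<times> ?D. obs1_fun E w u p \<theta> (e p)) ?I"
      by (rule indep_vars_restrict[OF indep_obs1_fun[OF \<open>P \<noteq> {}\<close>]])
         (auto simp: P_def disjoint_family_on_def)
    then have "indep_vars (\<lambda>_. obs_at_measure E)
        (\<lambda>i e. (\<lambda>g. \<lambda>d\<in>?D. g (i, d)) (\<lambda>p\<in>{i} \<times> ?D. obs1_fun E w u p \<theta> (e p))) ?I"
    proof (rule indep_vars_compose2)
      fix i
      show "(\<lambda>g. \<lambda>d\<in>?D. g (i, d)) \<in> PiM ({i} \<times> ?D) (\<lambda>_. obs_measure) \<rightarrow>\<^sub>M obs_at_measure E"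
        unfolding obs_at_measure_def by (rule measurable_restrict) (rule measurable_component_singleton, simp)
    qed
    moreover have "(\<lambda>d\<in>?D. (\<lambda>p\<in>{i} \<times> ?D. obs1_fun E w u p \<theta> (e p)) (i, d)) = obs_at_fun E w u i \<theta> e"
      for i e by (auto simp: obs_at_fun_def fun_eq_iff restrict_def)
    ultimately show ?thesis by simp
  qed
  then have "distr (PiM P \<nu>) (PiM ?I (\<lambda>_. obs_at_measure E)) (\<lambda>e. \<lambda>i\<in>?I. obs_at_fun E w u i \<theta> e)
      = PiM ?I (\<lambda>i. distr (PiM P \<nu>) (obs_at_measure E) (obs_at_fun E w u i \<theta>))"
    by (subst (asm) indep_vars_iff_distr_eq_PiM'[OF \<open>?I \<noteq> {}\<close>]) (use cm in auto)
  also have "\<dots> = PiM ?I (\<lambda>i. density (obs_at_measure E) (\<lambda>yi. ennreal (lik_at E w u i \<theta> yi)))"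
    by (rule PiM_cong[OF refl]) (rule obs_at_fun_law[OF _ ne(2)])
  also have "\<dots> = density (PiM ?I (\<lambda>_. obs_at_measure E)) (\<lambda>y. \<Prod>i\<in>?I. ennreal (lik_at E w u i \<theta> (y i)))"
  proof (rule PiM_density_finite)
    fix i assume i: "i \<in> ?I"
    have "(\<lambda>z. (\<lambda>(\<theta>, z). lik_at E w u i \<theta> z) (\<theta>, z)) \<in> borel_measurable (obs_at_measure E)"
      by (rule measurable_compose[OF _ lik_at_measurable[OF E u i]]) simp
    then show "(\<lambda>z. ennreal (lik_at E w u i \<theta> z)) \<in> borel_measurable (obs_at_measure E)" by simp
    show "prob_space (density (obs_at_measure E) (\<lambda>z. ennreal (lik_at E w u i \<theta> z)))"
      using prob_space_distr[OF cm[OF i]] obs_at_fun_law[OF i ne(2)] by simp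
  qed (simp_all add: sigma_finite_obs_at_measure)
  also have "(\<lambda>y. \<Prod>i\<in>?I. ennreal (lik_at E w u i \<theta> (y i))) = (\<lambda>y. ennreal (lik E w u \<theta> y))"
    unfolding lik_def by (intro ext prod_ennreal lik_at_nonneg[OF E])
  finally show ?thesis unfolding obs_vec_measure_def obs_fun_def[abs_def] .
qed

theorem distributed_param_obs_at:
  assumes ne: "1 \<le> num_times E" "1 \<le> num_sensors E" and i: "i \<in> {1..num_times E}"
  shows "distributed (sample_space E) (lborel \<Otimes>\<^sub>M obs_at_measure E)
    (\<lambda>\<omega>. (param E \<omega>, obs_at E w u i \<omega>)) (\<lambda>(\<theta>, yi). ennreal (prior E \<theta> * lik_at E w u i \<theta> yi))"
  unfolding obs_at_eq[OF i]
  by (rule obs_densities_prelim[OF E ne sigma_finite_obs_at_measure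
        obs_at_fun_meas[OF i, unfolded P_def] lik_at_measurable[OF E u i] lik_at_nonneg[OF E i]
        obs_at_fun_law[OF i ne(2), unfolded P_def \<nu>_def]])

theorem distributed_param_obs:
  assumes ne: "1 \<le> num_times E" "1 \<le> num_sensors E"
  shows "distributed (sample_space E) (lborel \<Otimes>\<^sub>M obs_vec_measure E)
    (\<lambda>\<omega>. (param E \<omega>, obs E w u \<omega>)) (\<lambda>(\<theta>, y). ennreal (prior E \<theta> * lik E w u \<theta> y))"
  unfolding obs_eq
  by (rule obs_densities_prelim[OF E ne sigma_finite_obs_vec_measure
        obs_fun_meas[unfolded P_def] lik_measurable[OF E u] lik_nonneg[OF E]
        obs_fun_law[OF ne, unfolded P_def \<nu>_def]])

end

end

theory Submission
  imports Defs
begin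

text \<open>
  Each inequality is an instance of Gibbs' inequality \<open>E (ln f - ln g) \<ge> 0\<close>, where \<open>f\<close> is the density
  of a random variable and \<open>g\<close> is a subdensity. Writing \<open>m\<close> and \<open>m\<^sub>i\<close> for the marginal densities of
  \<open>y\<close> and \<open>y\<^sub>i\<close>, the upper bound is the comparison of \<open>m\<close> with \<open>\<Prod>\<^sub>i m\<^sub>i\<close>. For the lower bound,
  \<open>I(\<theta>; y) \<ge> I(\<theta>; y\<^sub>i)\<close> holds for every \<open>i\<close> by comparing \<open>p\<^sub>0(\<theta>) p(y|\<theta>)\<close> with
  \<open>p\<^sub>0(\<theta>) p(y\<^sub>i|\<theta>) m(y) / m\<^sub>i(y\<^sub>i)\<close>; the times without a measurement contribute nothing to
  \<open>J\<^sub>i\<^sub>n\<^sub>s\<^sub>t\<close>, so summing over the remaining ones yields the factor \<open>K\<^sub>t\<^sub>i\<^sub>m\<^sub>e\<close>.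
\<close>

section \<open>Positivity of densities and Gibbs' inequality\<close>

lemma distributed_borel_measurable_ennreal:
  fixes f :: "'b \<Rightarrow> real"
  assumes "distributed M N X (\<lambda>x. ennreal (f x))" and "\<And>x. 0 \<le> f x"
  shows "f \<in> borel_measurable N"
proof -
  have "(\<lambda>x. enn2real (ennreal (f x))) \<in> borel_measurable N"
    using distributed_borel_measurable[OF assms(1)] by simp
  then show ?thesis using assms(2) by simp
qed

text \<open>The zero set of a density is null for the law it describes. This is what later permits
  splitting logarithms of products and quotients almost everywhere.\<close>

lemma distributed_AE_pos:
  fixes f :: "'b \<Rightarrow> real"
  assumes X: "distributed M N X (\<lambda>x. ennreal (f x))" and "\<And>x. 0 \<le> f x"
  shows "AE \<omega> in M. 0 < f (X \<omega>)"
proof -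
  note [measurable] = distributed_borel_measurable_ennreal[OF assms]
  have "AE x in distr M N X. 0 < f x"
    unfolding distributed_distr_eq_density[OF X] by (subst AE_density) simp_all
  then show ?thesis by (rule AE_distrD[OF distributed_measurable[OF X]])
qed

text \<open>With \<open>r = g / f\<close> along \<open>X\<close>, the integrand is
  \<open>- ln r\<close>, which is at least \<open>1 - r\<close>, and the mean of \<open>r\<close> is
  at most the total mass of \<open>g\<close>. Integrability is required only of the difference
  \<open>D\<close>, not of the two logarithms separately.\<close>

lemma (in prob_space) gibbs_inequality:
  fixes f g :: "'b \<Rightarrow> real"
  assumes X: "distributed M N X (\<lambda>x. ennreal (f x))" and f0: "\<And>x. 0 \<le> f x"
    and g [measurable]: "g \<in> borel_measurable N" and g0: "\<And>x. 0 \<le> g x"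
    and le: "(\<integral>\<^sup>+x. ennreal (g x) \<partial>N) \<le> 1"
    and D: "integrable M D"
    and ae: "AE \<omega> in M. 0 < g (X \<omega>) \<and> D \<omega> = ln (f (X \<omega>)) - ln (g (X \<omega>))"
  shows "0 \<le> (\<integral>\<omega>. D \<omega> \<partial>M)"
proof -
  note [measurable] = distributed_borel_measurable_ennreal[OF X f0] distributed_measurable[OF X]
  let ?r = "\<lambda>\<omega>. g (X \<omega>) / f (X \<omega>)"
  have "(\<integral>\<^sup>+\<omega>. ennreal (?r \<omega>) \<partial>M) = (\<integral>\<^sup>+x. ennreal (f x) * ennreal (g x / f x) \<partial>N)"
    by (rule distributed_nn_integral[OF X, symmetric]) simp
  \<comment> \<open>Only an inequality: where \<open>f\<close> vanishes the left integrand is 0,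
    whatever \<open>g\<close> is.\<close>
  also have "\<dots> \<le> (\<integral>\<^sup>+x. ennreal (g x) \<partial>N)"
    using f0 g0 by (intro nn_integral_mono) (simp add: ennreal_mult'[symmetric])
  also have "\<dots> \<le> 1" by (rule le)
  finally have nn: "(\<integral>\<^sup>+\<omega>. ennreal (?r \<omega>) \<partial>M) \<le> 1" .
  have r0: "0 \<le> ?r \<omega>" for \<omega> using f0 g0 by simp
  have r: "integrable M ?r"
    using nn r0 by (intro integrableI_nonneg) (auto intro: le_less_trans)
  have "ennreal (\<integral>\<omega>. ?r \<omega> \<partial>M) \<le> 1"
    using nn nn_integral_eq_integral[OF r] r0 by simp
  then have "(\<integral>\<omega>. ?r \<omega> \<partial>M) \<le> 1" by simp
  then have "0 \<le> (\<integral>\<omega>. 1 - ?r \<omega> \<partial>M)"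
    using r by (simp add: prob_space)
  also have "\<dots> \<le> (\<integral>\<omega>. D \<omega> \<partial>M)"
  proof (rule integral_mono_AE)
    show "AE \<omega> in M. 1 - ?r \<omega> \<le> D \<omega>"
      using ae distributed_AE_pos[OF X f0]
    proof eventually_elim
      case (elim \<omega>)
      then have "ln (?r \<omega>) \<le> ?r \<omega> - 1" by (intro ln_le_minus_one) simp
      then show ?case using elim by (simp add: ln_div)
    qed
  qed (use r D in simp_all)
  finally show ?thesis .
qed

section \<open>Information in an abstract Bayesian model with one observation\<close>

locale bayesian_observation = prob_space M + S: sigma_finite_measure S + R: sigma_finite_measure R
  for M :: "'o measure" and S :: "'t measure" and R :: "'y measure" +
  fixes X :: "'o \<Rightarrow> 't" and Y :: "'o \<Rightarrow> 'y" and p :: "'t \<Rightarrow> real" and l :: "'t \<Rightarrow> 'y \<Rightarrow> real"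
  assumes p_nonneg: "0 \<le> p \<theta>" and p_meas [measurable]: "p \<in> borel_measurable S"
    and l_nonneg: "0 \<le> l \<theta> y" and l_meas [measurable]: "case_prod l \<in> borel_measurable (S \<Otimes>\<^sub>M R)"
    and joint: "distributed M (S \<Otimes>\<^sub>M R) (\<lambda>\<omega>. (X \<omega>, Y \<omega>)) (\<lambda>(\<theta>, y). ennreal (p \<theta> * l \<theta> y))"
begin

sublocale SR: pair_sigma_finite S R ..

text \<open>A Bochner integral, with the factors in this order, so that it agrees literally with
  \<open>marg_at\<close> and \<open>marg\<close>; it is 0 at any \<open>y\<close> where the
  integrand is not integrable.\<close>

definition evidence :: "'y \<Rightarrow> real" where
  "evidence y = (\<integral>\<theta>. l \<theta> y * p \<theta> \<partial>S)"

lemma evidence_nonneg: "0 \<le> evidence y"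
  unfolding evidence_def using p_nonneg l_nonneg by (intro Bochner_Integration.integral_nonneg) simp

lemma integral_likelihood_measurable:
  fixes k :: "'t \<Rightarrow> 'y \<Rightarrow> real"
  assumes [measurable]: "case_prod k \<in> borel_measurable (S \<Otimes>\<^sub>M R)"
  shows "(\<lambda>y. \<integral>\<theta>. k \<theta> y * p \<theta> \<partial>S) \<in> borel_measurable R"
  by (rule S.borel_measurable_lebesgue_integral) measurable

lemma evidence_measurable [measurable]: "evidence \<in> borel_measurable R"
  unfolding evidence_def[abs_def] by (rule integral_likelihood_measurable) measurable

lemma joint': "distributed M (S \<Otimes>\<^sub>M R) (\<lambda>\<omega>. (X \<omega>, Y \<omega>)) (\<lambda>x. ennreal (p (fst x) * l (fst x) (snd x)))"
  using joint by (simp add: case_prod_beta')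

lemma likelihood_pos: "AE \<omega> in M. 0 < p (X \<omega>) \<and> 0 < l (X \<omega>) (Y \<omega>)"
proof -
  have "AE \<omega> in M. 0 < p (X \<omega>) * l (X \<omega>) (Y \<omega>)"
    using distributed_AE_pos[OF joint'] p_nonneg l_nonneg by simp
  then show ?thesis
    using p_nonneg l_nonneg by (auto simp: zero_less_mult_iff not_less[symmetric])
qed

text \<open>The marginal density arises as a nonnegative integral \<open>?q\<close>. Its total mass
  is 1, so it is finite almost everywhere, and there it coincides with the Bochner integral.\<close>

lemma distributed_evidence: "distributed M R Y (\<lambda>y. ennreal (evidence y))"
proof -
  let ?q = "\<lambda>y. \<integral>\<^sup>+\<theta>. ennreal (p \<theta> * l \<theta> y) \<partial>S"
  have q: "distributed M R Y ?q"
    using distr_marginal2[OF S.sigma_finite_measure_axioms R.sigma_finite_measure_axioms joint] by simp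
  note [measurable] = distributed_borel_measurable[OF q] distributed_measurable[OF q]
  have "(\<integral>\<^sup>+y. ?q y \<partial>R) = (\<integral>\<^sup>+y. ?q y * indicator (space R) y \<partial>R)"
    by (rule nn_integral_cong) simp
  also have "\<dots> = emeasure (distr M R Y) (space R)"
    using q by (simp add: distributed_def emeasure_density)
  also have "\<dots> = 1"
    using prob_space.emeasure_space_1[OF prob_space_distr[of Y R]] by simp
  finally have "AE y in R. ?q y \<noteq> \<infinity>"
    by (intro nn_integral_noteq_infinite) simp_all
  then have "AE y in R. ?q y = ennreal (evidence y)"
    using AE_space
  proof eventually_elim
    case (elim y)
    note [measurable] = \<open>y \<in> space R\<close>
    have "integrable S (\<lambda>\<theta>. p \<theta> * l \<theta> y)"
      using elim p_nonneg l_nonneg by (intro integrableI_nonneg) (auto simp: less_top)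
    then show ?case
      unfolding evidence_def using p_nonneg l_nonneg
      by (subst nn_integral_eq_integral) (simp_all add: mult.commute)
  qed
  then have "density R ?q = density R (\<lambda>y. ennreal (evidence y))"
    by (intro density_cong) simp_all
  then show ?thesis using q by (simp add: distributed_def)
qed

lemma nn_integral_evidence: "(\<integral>\<^sup>+y. ennreal (evidence y) \<partial>R) = 1"
proof -
  note [measurable] = distributed_measurable[OF distributed_evidence]
  have "(\<integral>\<^sup>+y. ennreal (evidence y) * 1 \<partial>R) = (\<integral>\<^sup>+\<omega>. 1 \<partial>M)"
    by (rule distributed_nn_integral[OF distributed_evidence]) simp
  then show ?thesis by (simp add: emeasure_space_1)
qed

lemma evidence_pos: "AE \<omega> in M. 0 < evidence (Y \<omega>)"
  by (rule distributed_AE_pos[OF distributed_evidence evidence_nonneg])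

text \<open>
  With \<open>n\<close> the normalising constant, \<open>k \<theta> y * p \<theta> / n y\<close> is an arbitrary guess of the posterior
  density of \<open>\<theta>\<close> given \<open>y\<close>, and the true posterior is the best one.
\<close>

lemma information_ge_mismatched:
  fixes k :: "'t \<Rightarrow> 'y \<Rightarrow> real" and n :: "'y \<Rightarrow> real"
  assumes k [measurable]: "case_prod k \<in> borel_measurable (S \<Otimes>\<^sub>M R)"
    and k0: "\<And>\<theta> y. 0 \<le> k \<theta> y"
    and n: "\<And>y. n y = (\<integral>\<theta>. k \<theta> y * p \<theta> \<partial>S)"
    and pos: "AE \<omega> in M. 0 < k (X \<omega>) (Y \<omega>) \<and> 0 < n (Y \<omega>)"
    and I: "integrable M I" "AE \<omega> in M. I \<omega> = ln (l (X \<omega>) (Y \<omega>)) - ln (evidence (Y \<omega>))"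
    and J: "integrable M J" "AE \<omega> in M. J \<omega> = ln (k (X \<omega>) (Y \<omega>)) - ln (n (Y \<omega>))"
  shows "(\<integral>\<omega>. J \<omega> \<partial>M) \<le> (\<integral>\<omega>. I \<omega> \<partial>M)"
proof -
  have n0: "0 \<le> n y" for y
    unfolding n using p_nonneg k0 by (intro Bochner_Integration.integral_nonneg) simp
  have [measurable]: "n \<in> borel_measurable R"
    unfolding n[abs_def] by (rule integral_likelihood_measurable) measurable
  \<comment> \<open>The marginal density of \<open>Y\<close> times the guessed posterior. Where
    \<open>n\<close> vanishes, division by zero makes \<open>g\<close> vanish too; elsewhere its
    integral over the parameter is \<open>evidence y\<close>. Hence the total mass is at most
    1.\<close>
  define g where "g x = evidence (snd x) / n (snd x) * (k (fst x) (snd x) * p (fst x))" for x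
  have [measurable]: "g \<in> borel_measurable (S \<Otimes>\<^sub>M R)"
    unfolding g_def[abs_def] by measurable
  have "(\<integral>\<^sup>+x. ennreal (g x) \<partial>(S \<Otimes>\<^sub>M R)) = (\<integral>\<^sup>+y. \<integral>\<^sup>+\<theta>. ennreal (g (\<theta>, y)) \<partial>S \<partial>R)"
    by (rule SR.nn_integral_snd[symmetric]) measurable
  also have "\<dots> \<le> (\<integral>\<^sup>+y. ennreal (evidence y) \<partial>R)"
  proof (rule nn_integral_mono)
    fix y assume [measurable]: "y \<in> space R"
    show "(\<integral>\<^sup>+\<theta>. ennreal (g (\<theta>, y)) \<partial>S) \<le> ennreal (evidence y)"
    proof (cases "n y = 0")
      case False
      \<comment> \<open>A nonintegrable function has Bochner integral 0, so a nonzero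
        \<open>n y\<close> forces integrability.\<close>
      then have int: "integrable S (\<lambda>\<theta>. k \<theta> y * p \<theta>)"
        unfolding n by (metis not_integrable_integral_eq)
      then have "(\<integral>\<^sup>+\<theta>. ennreal (g (\<theta>, y)) \<partial>S) = ennreal (\<integral>\<theta>. g (\<theta>, y) \<partial>S)"
        using p_nonneg k0 n0 evidence_nonneg
        by (intro nn_integral_eq_integral) (simp_all add: g_def)
      also have "(\<integral>\<theta>. g (\<theta>, y) \<partial>S) = evidence y"
        using False by (simp add: g_def n[symmetric])
      finally show ?thesis by simp
    qed (simp add: g_def)
  qed
  finally have "(\<integral>\<^sup>+x. ennreal (g x) \<partial>(S \<Otimes>\<^sub>M R)) \<le> 1"
    by (simp add: nn_integral_evidence)
  then have "0 \<le> (\<integral>\<omega>. I \<omega> - J \<omega> \<partial>M)"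
  proof (rule gibbs_inequality[OF joint', rotated 3])
    \<comment> \<open>The prior density is a factor of both arguments and cancels;
      \<open>likelihood_pos\<close> makes it positive.\<close>
    show "AE \<omega> in M. 0 < g (X \<omega>, Y \<omega>) \<and> I \<omega> - J \<omega>
        = ln (p (fst (X \<omega>, Y \<omega>)) * l (fst (X \<omega>, Y \<omega>)) (snd (X \<omega>, Y \<omega>))) - ln (g (X \<omega>, Y \<omega>))"
      using pos likelihood_pos evidence_pos I(2) J(2)
      by eventually_elim (simp add: g_def ln_mult ln_div)
  qed (use p_nonneg l_nonneg k0 n0 evidence_nonneg I(1) J(1) in \<open>simp_all add: g_def\<close>)
  then show ?thesis using I(1) J(1) by simp
qed

text \<open>The guess that ignores \<open>y\<close> and returns the prior has information 0.\<close>

lemma information_nonneg: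
  assumes "integrable M I" "AE \<omega> in M. I \<omega> = ln (l (X \<omega>) (Y \<omega>)) - ln (evidence (Y \<omega>))"
    and p1: "(\<integral>\<theta>. p \<theta> \<partial>S) = 1"
  shows "0 \<le> (\<integral>\<omega>. I \<omega> \<partial>M)"
  using information_ge_mismatched[of "\<lambda>_ _. 1" "\<lambda>_. 1" I "\<lambda>_. 0"] assms by simp

end

section \<open>The controlled experiment as an instance of the abstract model\<close>

context
  fixes E :: "('nx::finite, 'nu::finite, 'nt::finite, 'ny::finite, 'o) exp_model"
    and w :: "nat \<Rightarrow> nat \<Rightarrow> nat" and u :: "real \<Rightarrow> real^'nu"
  assumes E: "controlled_experiment E" and u: "u \<in> controls E"
    and ne: "1 \<le> num_times E" "1 \<le> num_sensors E"
begin

lemma prior_nonneg: "0 \<le> prior E \<theta>"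
  using E by (simp add: controlled_experiment_def)

lemma distributed_prior: "distributed (sample_space E) lborel (param E) (\<lambda>\<theta>. ennreal (prior E \<theta>))"
  using E by (simp add: controlled_experiment_def)

lemma prior_measurable: "prior E \<in> borel_measurable lborel"
  by (rule distributed_borel_measurable_ennreal[OF distributed_prior prior_nonneg])

lemma prob_space_sample_space: "prob_space (sample_space E)"
  using E by (simp add: controlled_experiment_def)

lemma integral_prior: "(\<integral>\<theta>. prior E \<theta> \<partial>lborel) = 1"
proof -
  interpret prob_space "sample_space E" by (rule prob_space_sample_space)
  show ?thesis
    using distributed_integral[OF distributed_prior, of "\<lambda>_. 1"] prior_nonneg by (simp add: prob_space)
qed

lemma bayesian_observation_obs_at:
  assumes i: "i \<in> {1..num_times E}"
  shows "bayesian_observation (sample_space E) lborel (obs_at_measure E) (param E) (obs_at E w u i)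
    (prior E) (lik_at E w u i)"
proof -
  interpret prob_space "sample_space E" by (rule prob_space_sample_space)
  interpret R: sigma_finite_measure "obs_at_measure E" by (rule sigma_finite_obs_at_measure)
  show ?thesis
  proof
    show "case_prod (lik_at E w u i) \<in> borel_measurable (lborel \<Otimes>\<^sub>M obs_at_measure E)"
      using lik_at_measurable[OF E u i] by (simp cong: measurable_cong_sets sets_pair_measure_cong)
  qed (use prior_nonneg prior_measurable lik_at_nonneg[OF E i] distributed_param_obs_at[OF E u ne i] in auto)
qed

lemma bayesian_observation_obs:
  "bayesian_observation (sample_space E) lborel (obs_vec_measure E) (param E) (obs E w u)
    (prior E) (lik E w u)"
proof -
  interpret prob_space "sample_space E" by (rule prob_space_sample_space)
  interpret R: sigma_finite_measure "obs_vec_measure E" by (rule sigma_finite_obs_vec_measure)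
  show ?thesis
  proof
    show "case_prod (lik E w u) \<in> borel_measurable (lborel \<Otimes>\<^sub>M obs_vec_measure E)"
      using lik_measurable[OF E u] by (simp cong: measurable_cong_sets sets_pair_measure_cong)
  qed (use prior_nonneg prior_measurable lik_nonneg[OF E] distributed_param_obs[OF E u ne] in auto)
qed

lemma evidence_obs_at:
  "i \<in> {1..num_times E} \<Longrightarrow>
    bayesian_observation.evidence lborel (prior E) (lik_at E w u i) = marg_at E w u i"
  by (simp add: fun_eq_iff marg_at_def bayesian_observation.evidence_def[OF bayesian_observation_obs_at])

lemma evidence_obs: "bayesian_observation.evidence lborel (prior E) (lik E w u) = marg E w u"
  by (simp add: fun_eq_iff marg_def bayesian_observation.evidence_def[OF bayesian_observation_obs])

lemma lik_pos: "AE \<omega> in sample_space E. 0 < lik E w u (param E \<omega>) (obs E w u \<omega>)"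
  using bayesian_observation.likelihood_pos[OF bayesian_observation_obs] by eventually_elim simp

lemma lik_at_pos:
  "AE \<omega> in sample_space E. \<forall>i\<in>{1..num_times E}. 0 < lik_at E w u i (param E \<omega>) (obs_at E w u i \<omega>)"
  using bayesian_observation.likelihood_pos[OF bayesian_observation_obs_at]
  by (intro AE_finite_allI) auto

lemma marg_pos: "AE \<omega> in sample_space E. 0 < marg E w u (obs E w u \<omega>)"
  using bayesian_observation.evidence_pos[OF bayesian_observation_obs] by (simp add: evidence_obs)

lemma marg_at_pos:
  "AE \<omega> in sample_space E. \<forall>i\<in>{1..num_times E}. 0 < marg_at E w u i (obs_at E w u i \<omega>)"
  using bayesian_observation.evidence_pos[OF bayesian_observation_obs_at]
  by (intro AE_finite_allI) (simp_all add: evidence_obs_at)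

text \<open>Brings the logarithm of a quotient into the form of a difference, as in
  \<open>inst_info_density\<close>.\<close>

lemma EIG_density_eq:
  "AE \<omega> in sample_space E. EIG_density E w u \<omega>
    = ln (lik E w u (param E \<omega>) (obs E w u \<omega>)) - ln (marg E w u (obs E w u \<omega>))"
  using lik_pos marg_pos by eventually_elim (simp add: EIG_density_def ln_div)

section \<open>Comparison of \<open>J_EIG\<close> with the instantaneous terms\<close>

lemma J_EIG_nonneg:
  assumes "finite_information E w u"
  shows "0 \<le> J_EIG E w u"
  using bayesian_observation.information_nonneg[OF bayesian_observation_obs, of "EIG_density E w u"]
    assms EIG_density_eq integral_prior
  by (simp add: evidence_obs J_EIG_def finite_information_def)

text \<open>The posterior computed from the component \<open>y i\<close> alone is one possible guess
  of the posterior given all of \<open>y\<close>, so \<open>information_ge_mismatched\<close>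
  applies.\<close>

lemma I_inst_le_J_EIG:
  assumes fin: "finite_information E w u" and i: "i \<in> {1..num_times E}"
  shows "I_inst E w u i \<le> J_EIG E w u"
proof -
  interpret O: bayesian_observation "sample_space E" lborel "obs_vec_measure E" "param E" "obs E w u"
      "prior E" "lik E w u"
    by (rule bayesian_observation_obs)
  have obs_i: "obs E w u \<omega> i = obs_at E w u i \<omega>" for \<omega> using i by (simp add: obs_def)
  show ?thesis
    unfolding I_inst_def J_EIG_def
  proof (rule O.information_ge_mismatched[where k = "\<lambda>\<theta> y. lik_at E w u i \<theta> (y i)"
        and n = "\<lambda>y. marg_at E w u i (y i)"])
    have "(\<lambda>x. (\<lambda>(\<theta>, z). lik_at E w u i \<theta> z) (fst x, snd x i))
        \<in> borel_measurable (borel \<Otimes>\<^sub>M obs_vec_measure E)"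
      by (rule measurable_compose[OF _ lik_at_measurable[OF E u i]])
         (unfold obs_vec_measure_def, use i in measurable)
    then show "(\<lambda>(\<theta>, y). lik_at E w u i \<theta> (y i)) \<in> borel_measurable (lborel \<Otimes>\<^sub>M obs_vec_measure E)"
      by (simp add: case_prod_beta' cong: measurable_cong_sets sets_pair_measure_cong)
    show "AE \<omega> in sample_space E. 0 < lik_at E w u i (param E \<omega>) (obs E w u \<omega> i)
        \<and> 0 < marg_at E w u i (obs E w u \<omega> i)"
      using lik_at_pos marg_at_pos by eventually_elim (use i in \<open>simp add: obs_i\<close>)
    show "AE \<omega> in sample_space E. inst_info_density E w u i \<omega>
        = ln (lik_at E w u i (param E \<omega>) (obs E w u \<omega> i)) - ln (marg_at E w u i (obs E w u \<omega> i))"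
      by (simp add: inst_info_density_def obs_i)
  qed (use fin i lik_at_nonneg[OF E i] EIG_density_eq in
      \<open>simp_all add: marg_at_def finite_information_def evidence_obs\<close>)
qed

text \<open>Tonelli splits the integral into factors of mass 1. This is the mass bound for the
  competitor density in \<open>J_EIG_le_J_inst\<close>.\<close>

lemma nn_integral_prod_marg_at:
  "(\<integral>\<^sup>+y. ennreal (\<Prod>i\<in>{1..num_times E}. marg_at E w u i (y i)) \<partial>obs_vec_measure E) = 1"
proof -
  interpret product_sigma_finite "\<lambda>_. obs_at_measure E"
    by (simp add: product_sigma_finite_def sigma_finite_obs_at_measure)
  have m: "marg_at E w u i \<in> borel_measurable (obs_at_measure E)"
      "(\<integral>\<^sup>+z. ennreal (marg_at E w u i z) \<partial>obs_at_measure E) = 1" "\<And>z. 0 \<le> marg_at E w u i z"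
    if i: "i \<in> {1..num_times E}" for i
    using bayesian_observation.evidence_measurable[OF bayesian_observation_obs_at[OF i]]
      bayesian_observation.nn_integral_evidence[OF bayesian_observation_obs_at[OF i]]
      bayesian_observation.evidence_nonneg[OF bayesian_observation_obs_at[OF i]]
    by (simp_all add: evidence_obs_at[OF i])
  have "(\<integral>\<^sup>+y. ennreal (\<Prod>i\<in>{1..num_times E}. marg_at E w u i (y i)) \<partial>obs_vec_measure E)
      = (\<integral>\<^sup>+y. (\<Prod>i\<in>{1..num_times E}. ennreal (marg_at E w u i (y i))) \<partial>obs_vec_measure E)"
    using m(3) by (intro nn_integral_cong prod_ennreal[symmetric]) auto
  also have "\<dots> = (\<Prod>i\<in>{1..num_times E}. \<integral>\<^sup>+z. ennreal (marg_at E w u i z) \<partial>obs_at_measure E)"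
    unfolding obs_vec_measure_def using m(1) by (intro product_nn_integral_prod) auto
  also have "\<dots> = 1" using m(2) by simp
  finally show ?thesis .
qed

text \<open>Conditional independence enters through the product form of \<open>lik\<close>: the
  likelihood terms of \<open>?D\<close> cancel, leaving the log ratio of the joint marginal density
  to the product \<open>?q\<close> of the marginals. The gap is thus a relative entropy.\<close>

lemma J_EIG_le_J_inst:
  assumes fin: "finite_information E w u"
  shows "J_EIG E w u \<le> J_inst E w u"
proof -
  let ?I = "{1..num_times E}"
  interpret O: bayesian_observation "sample_space E" lborel "obs_vec_measure E" "param E" "obs E w u"
      "prior E" "lik E w u"
    by (rule bayesian_observation_obs)
  let ?D = "\<lambda>\<omega>. (\<Sum>i\<in>?I. inst_info_density E w u i \<omega>) - EIG_density E w u \<omega>"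
  let ?q = "\<lambda>y. \<Prod>i\<in>?I. marg_at E w u i (y i)"
  have m: "(\<lambda>y. marg_at E w u i (y i)) \<in> borel_measurable (obs_vec_measure E)"
      "0 \<le> marg_at E w u i z" if i: "i \<in> ?I" for i z
    using bayesian_observation.evidence_measurable[OF bayesian_observation_obs_at[OF i]] i
      bayesian_observation.evidence_nonneg[OF bayesian_observation_obs_at[OF i]]
    unfolding obs_vec_measure_def evidence_obs_at[OF i]
    by (auto intro!: measurable_compose[OF measurable_component_singleton])
  have "0 \<le> (\<integral>\<omega>. ?D \<omega> \<partial>sample_space E)"
  proof (rule O.gibbs_inequality[OF O.distributed_evidence O.evidence_nonneg, where g = ?q])
    show "AE \<omega> in sample_space E. 0 < ?q (obs E w u \<omega>) \<and>
        ?D \<omega> = ln (O.evidence (obs E w u \<omega>)) - ln (?q (obs E w u \<omega>))"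
      using lik_at_pos marg_at_pos EIG_density_eq
    proof eventually_elim
      case (elim \<omega>)
      then have "ln (\<Prod>i\<in>?I. lik_at E w u i (param E \<omega>) (obs_at E w u i \<omega>))
            = (\<Sum>i\<in>?I. ln (lik_at E w u i (param E \<omega>) (obs_at E w u i \<omega>)))"
          "ln (\<Prod>i\<in>?I. marg_at E w u i (obs_at E w u i \<omega>))
            = (\<Sum>i\<in>?I. ln (marg_at E w u i (obs_at E w u i \<omega>)))"
        by (force intro!: ln_prod)+
      then show ?case
        using elim by (auto simp: evidence_obs lik_def obs_def inst_info_density_def sum_subtractf
            intro!: prod_pos)
    qed
    show "integrable (sample_space E) ?D"
      using fin unfolding finite_information_def
      by (intro Bochner_Integration.integrable_diff Bochner_Integration.integrable_sum) auto
    show "(\<integral>\<^sup>+y. ennreal (?q y) \<partial>obs_vec_measure E) \<le> 1"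
      by (rule eq_refl[OF nn_integral_prod_marg_at])
  qed (use m in \<open>auto intro!: prod_nonneg borel_measurable_prod\<close>)
  also have "\<dots> = J_inst E w u - J_EIG E w u"
    using fin unfolding J_EIG_def J_inst_def I_inst_def finite_information_def
    by (subst Bochner_Integration.integral_diff) (auto intro: Bochner_Integration.integral_sum)
  finally show ?thesis by simp
qed

text \<open>Every sensor returns \<open>None\<close>, which has likelihood 1 under any parameter.
  The marginal is then the mass of the prior, also 1, and both logarithms vanish.\<close>

lemma I_inst_unmeasured:
  assumes "\<And>d. d \<in> {1..num_sensors E} \<Longrightarrow> w i d = 0"
  shows "I_inst E w u i = 0"
proof -
  have "lik_at E w u i \<theta> (obs_at E w u i \<omega>) = 1" for \<theta> \<omega>
    unfolding lik_at_def using assms by (intro prod.neutral) (simp add: obs_at_def obs1_def lik1_def)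
  then show ?thesis
    by (simp add: I_inst_def inst_info_density_def marg_at_def integral_prior)
qed

end

section \<open>Counting measured times and the final estimate\<close>

lemma K_time_le:
  fixes w :: "nat \<Rightarrow> nat \<Rightarrow> nat"
  shows "K_time E w \<le> (\<Sum>i\<in>{1..num_times E}. \<Sum>d\<in>{1..num_sensors E}. w i d)"
proof -
  let ?A = "{i \<in> {1..num_times E}. (\<Sum>d\<in>{1..num_sensors E}. w i d) > 0}"
  have "K_time E w = (\<Sum>i\<in>?A. 1)" by (simp add: K_time_def)
  \<comment> \<open>The weights are natural numbers, so a positive row sum is at least 1.\<close>
  also have "\<dots> \<le> (\<Sum>i\<in>?A. \<Sum>d\<in>{1..num_sensors E}. w i d)"
    by (rule sum_mono) (simp add: Suc_le_eq)
  also have "\<dots> \<le> (\<Sum>i\<in>{1..num_times E}. \<Sum>d\<in>{1..num_sensors E}. w i d)"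
    by (rule sum_mono2) auto
  finally show ?thesis .
qed

theorem proposition1:
  fixes E :: "('nx::finite, 'nu::finite, 'nt::finite, 'ny::finite, 'o) exp_model"
    and w :: "nat \<Rightarrow> nat \<Rightarrow> nat" and u :: "real \<Rightarrow> real^'nu"
  assumes "controlled_experiment E"
    and "admissible E w u"
    and "finite_information E w u"
    and "\<exists>i\<in>{1..num_times E}. \<exists>d\<in>{1..num_sensors E}. w i d = 1"
  shows "(1 / real (K_time E w) * J_inst E w u \<le> J_EIG E w u \<and> J_EIG E w u \<le> J_inst E w u) \<and>
         K_time E w \<le> budget E \<and>
         (1 / real (budget E) * J_inst E w u \<le> J_EIG E w u \<and> J_EIG E w u \<le> J_inst E w u)"
proof -
  let ?A = "{i \<in> {1..num_times E}. (\<Sum>d\<in>{1..num_sensors E}. w i d) > 0}"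
  have u: "u \<in> controls E" and budget: "K_time E w \<le> budget E"
    using assms(2) K_time_le[of E w] by (auto simp: admissible_def)
  obtain i d where id: "i \<in> {1..num_times E}" "d \<in> {1..num_sensors E}" "w i d = 1"
    using assms(4) by blast
  \<comment> \<open>The measured pair shows that both index sets are nonempty, as the density
    results require.\<close>
  then have ne: "1 \<le> num_times E" "1 \<le> num_sensors E" by auto
  have "w i d \<le> (\<Sum>d\<in>{1..num_sensors E}. w i d)" using id(2) by (intro member_le_sum) auto
  then have "i \<in> ?A" using id by simp
  then have "?A \<noteq> {}" by blast
  then have K0: "0 < K_time E w" unfolding K_time_def card_gt_0_iff by simp
  \<comment> \<open>Dropping the vanishing terms first makes the factor \<open>K_time\<close> rather
    than \<open>num_times\<close>.\<close>
  have "J_inst E w u = (\<Sum>i\<in>?A. I_inst E w u i)"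
    unfolding J_inst_def
  proof (rule sum.mono_neutral_right)
    show "\<forall>i\<in>{1..num_times E} - ?A. I_inst E w u i = 0"
      by (intro ballI I_inst_unmeasured[OF assms(1) u ne]) simp
  qed auto
  also have "\<dots> \<le> real (K_time E w) * J_EIG E w u"
    unfolding K_time_def
    by (rule sum_bounded_above) (auto intro: I_inst_le_J_EIG[OF assms(1) u ne assms(3)])
  finally have le: "J_inst E w u \<le> real (K_time E w) * J_EIG E w u" .
  have up: "0 \<le> J_EIG E w u" "J_EIG E w u \<le> J_inst E w u"
    using J_EIG_nonneg[OF assms(1) u ne assms(3)] J_EIG_le_J_inst[OF assms(1) u ne assms(3)] .
  \<comment> \<open>Enlarging the factor to the budget is legitimate because \<open>J_EIG\<close> is
    nonnegative. By \<open>K0\<close> and \<open>budget\<close> both denominators are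
    positive.\<close>
  have "real (K_time E w) * J_EIG E w u \<le> real (budget E) * J_EIG E w u"
    using budget up by (intro mult_right_mono) auto
  then show ?thesis
    using le up K0 budget by (auto simp: field_simps)
qed

end
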